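(* Let $x_a\in\mathbb{R}$ be fixed, let $L:[a,b]\times\mathbb{R}^2\to\mathbb{R}$ be differentiable and $\phi:[a,b]\times\mathbb{R}\to\mathbb{R}$ be of class $C^1$. Let $(x,T)$ be a local minimizer of $$\mathcal{J}(x,T)=\int_a^T L[x]_\gamma^{\alpha,\beta}(t)\,dt+\phi(T,x(T))$$ on $D$, subject to the boundary condition $x(a)=x_a$ ($T$ and $x(T)$ being free). Then $(x,T)$ satisfies the fractional Euler--Lagrange equations $$\partial_2L[x]_\gamma^{\alpha,\beta}(t)+D_{\overline\gamma}^{\beta(\cdot,\cdot),\alpha(\cdot,\cdot)}\partial_3L[x]_\gamma^{\alpha,\beta}(t)=0\quad\text{on }[a,T],$$ $$\gamma_2\left({}_aD_t^{\beta(\cdot,\cdot)}\partial_3L[x]_\gamma^{\alpha,\beta}(t)-{}_TD_t^{\beta(\cdot,\cdot)}\partial_3L[x]_\gamma^{\alpha,\beta}(t)\right)=0\quad\text{on }[T,b],$$ together with the transversality conditions $$ \begin{cases} L[x]_\gamma^{\alpha,\beta}(T)+\partial_1\phi(T,x(T))\\ \quad+x'(T)\left[\gamma_2\,{}_TI_t^{1-\beta(\cdot,\cdot)}\partial_3L[x]_\gamma^{\alpha,\beta}(t)-\gamma_1\,{}_tI_T^{1-\alpha(\cdot,\cdot)}\partial_3L[x]_\gamma^{\alpha,\beta}(t)\right]_{t=T}=0,\\ \left[\gamma_1\,{}_tI_T^{1-\alpha(\cdot,\cdot)}\partial_3L[x]_\gamma^{\alpha,\beta}(t)-\gamma_2\,{}_TI_t^{1-\beta(\cdot,\cdot)}\partial_3L[x]_\gamma^{\alpha,\beta}(t)\right]_{t=T}+\partial_2\phi(T,x(T))=0,\\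 \gamma_2\left[{}_TI_t^{1-\beta(\cdot,\cdot)}\partial_3L[x]_\gamma^{\alpha,\beta}(t)-{}_aI_t^{1-\beta(\cdot,\cdot)}\partial_3L[x]_\gamma^{\alpha,\beta}(t)\right]_{t=b}=0. \end{cases} $$
   Context: Let $a<b$ be reals, $\alpha,\beta:[a,b]^2\to(0,1)$ continuous functions, and $\gamma=(\gamma_1,\gamma_2)\in[0,1]^2$ with $\gamma_1,\gamma_2$ not both zero; $\overline\gamma=(\gamma_2,\gamma_1)$. For $c\in[a,b]$ and $\delta\in\{\alpha,\beta\}$ define the variable-order Riemann--Liouville integrals $${}_cI_t^{1-\delta(\cdot,\cdot)}f(t)=\int_c^t\frac{(t-\tau)^{-\delta(t,\tau)}}{\Gamma(1-\delta(t,\tau))}f(\tau)\,d\tau\ (t>c),\qquad {}_tI_c^{1-\delta(\cdot,\cdot)}f(t)=\int_t^c\frac{(\tau-t)^{-\delta(\tau,t)}}{\Gamma(1-\delta(\tau,t))}f(\tau)\,d\tau\ (t<c),$$ the Riemann--Liouville derivatives ${}_cD_t^{\delta(\cdot,\cdot)}f(t)=\frac{d}{dt}\,{}_cI_t^{1-\delta(\cdot,\cdot)}f(t)$ and ${}_tD_c^{\delta(\cdot,\cdot)}f(t)=-\frac{d}{dt}\,{}_tI_c^{1-\delta(\cdot,\cdot)}f(t)$, and the Caputo derivatives ${}_a^CD_t^{\alpha(\cdot,\cdot)}x(t)={}_aI_t^{1-\alpha(\cdot,\cdot)}x'(t)$ and ${}_t^CD_b^{\beta(\cdot,\cdot)}x(t)=-{}_tI_b^{1-\beta(\cdot,\cdot)}x'(t)$.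 The combined Caputo fractional derivative is ${}^CD_\gamma^{\alpha(\cdot,\cdot),\beta(\cdot,\cdot)}x(t)=\gamma_1\,{}_a^CD_t^{\alpha(\cdot,\cdot)}x(t)+\gamma_2\,{}_t^CD_b^{\beta(\cdot,\cdot)}x(t)$, and the dual derivative is $D_{\overline\gamma}^{\beta(\cdot,\cdot),\alpha(\cdot,\cdot)}=\gamma_2\,{}_aD_t^{\beta(\cdot,\cdot)}+\gamma_1\,{}_tD_T^{\alpha(\cdot,\cdot)}$. Notation: $[x]_\gamma^{\alpha,\beta}(t)=\left(t,x(t),{}^CD_\gamma^{\alpha(\cdot,\cdot),\beta(\cdot,\cdot)}x(t)\right)$; $F[x]_\gamma^{\alpha,\beta}(t)$ means $F$ evaluated at this vector; $\partial_iF$ is the partial derivative with respect to the $i$th argument. $D=\{(x,t)\in C^1([a,b])\times[a,b]:\ {}^CD_\gamma^{\alpha(\cdot,\cdot),\beta(\cdot,\cdot)}x\in C([a,b])\}$, with norm $\|(x,t)\|=\max_{[a,b]}|x|+\max_{[a,b]}|{}^CD_\gamma^{\alpha(\cdot,\cdot),\beta(\cdot,\cdot)}x|+|t|$. $(x^\star,T^\star)$ is a local minimizer if for some $\epsilon>0$, $\mathcal{J}(x^\star,T^\star)\le\mathcal{J}(x,T)$ for all admissible $(x,T)\in D$ with $\|(x^\star,T^\star)-(x,T)\|<\epsilon$.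
   Formalization: Proved for a<T<b, with ∂₂L and ∂₃L assumed continuous; the Euler–Lagrange equations are given as derivatives of the combined Riemann–Liouville integrals, and with the individual derivatives at each point where these exist. *)

theory Defs
  imports "HOL-Analysis.Analysis"
begin

text \<open>
  Functions on \<open>[a,b]\<close> are represented by total functions on the reals of which only the
  values on \<open>[a,b]\<close> are ever used.  In particular a derivative at an endpoint is one-sided:
  it is taken within the interval on which the function is defined.
\<close>

abbreviation deriv_on :: "real set \<Rightarrow> (real \<Rightarrow> real) \<Rightarrow> real \<Rightarrow> real" where
  "deriv_on S f t \<equiv> vector_derivative f (at t within S)"

definition C1_on :: "real set \<Rightarrow> (real \<Rightarrow> real) \<Rightarrow> bool" where
  "C1_on S f \<longleftrightarrow> f differentiable_on S \<and> continuous_on S (deriv_on S f)"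

text \<open>
  Variable-order Riemann--Liouville integrals of order \<open>1 - \<delta>(\<cdot>,\<cdot>)\<close>, from \<open>c\<close> to \<open>t\<close> and from
  \<open>t\<close> to \<open>c\<close> respectively; at \<open>t = c\<close> they are integrals over a null set, hence \<open>0\<close>.
  Note that the larger time is always the first argument of \<open>\<delta>\<close>.
\<close>

definition left_RL_integral :: "(real \<Rightarrow> real \<Rightarrow> real) \<Rightarrow> real \<Rightarrow> (real \<Rightarrow> real) \<Rightarrow> real \<Rightarrow> real" where
  "left_RL_integral \<delta> c f t =
     (LINT \<tau>:{c..t}|lborel. (t - \<tau>) powr (- \<delta> t \<tau>) / Gamma (1 - \<delta> t \<tau>) * f \<tau>)"

definition right_RL_integral :: "(real \<Rightarrow> real \<Rightarrow> real) \<Rightarrow> real \<Rightarrow> (real \<Rightarrow> real) \<Rightarrow> real \<Rightarrow> real" where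
  "right_RL_integral \<delta> c f t =
     (LINT \<tau>:{t..c}|lborel. (\<tau> - t) powr (- \<delta> \<tau> t) / Gamma (1 - \<delta> \<tau> t) * f \<tau>)"

text \<open>
  Riemann--Liouville derivatives on \<open>[a,b]\<close>.  The left integral based at \<open>c\<close> is a function on
  \<open>[c,b]\<close>, the right one a function on \<open>[a,c]\<close>.  The two predicates say that the derivative
  exists at \<open>t\<close>; otherwise the value of the corresponding function is meaningless.
\<close>

definition left_RL_differentiable ::
  "real \<Rightarrow> (real \<Rightarrow> real \<Rightarrow> real) \<Rightarrow> real \<Rightarrow> (real \<Rightarrow> real) \<Rightarrow> real \<Rightarrow> bool" where
  "left_RL_differentiable b \<delta> c f t \<longleftrightarrow>
     left_RL_integral \<delta> c f differentiable (at t within {c..b})"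

definition left_RL_derivative ::
  "real \<Rightarrow> (real \<Rightarrow> real \<Rightarrow> real) \<Rightarrow> real \<Rightarrow> (real \<Rightarrow> real) \<Rightarrow> real \<Rightarrow> real" where
  "left_RL_derivative b \<delta> c f t = deriv_on {c..b} (left_RL_integral \<delta> c f) t"

definition right_RL_differentiable ::
  "real \<Rightarrow> (real \<Rightarrow> real \<Rightarrow> real) \<Rightarrow> real \<Rightarrow> (real \<Rightarrow> real) \<Rightarrow> real \<Rightarrow> bool" where
  "right_RL_differentiable a \<delta> c f t \<longleftrightarrow>
     right_RL_integral \<delta> c f differentiable (at t within {a..c})"

definition right_RL_derivative ::
  "real \<Rightarrow> (real \<Rightarrow> real \<Rightarrow> real) \<Rightarrow> real \<Rightarrow> (real \<Rightarrow> real) \<Rightarrow> real \<Rightarrow> real" where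
  "right_RL_derivative a \<delta> c f t = - deriv_on {a..c} (right_RL_integral \<delta> c f) t"

definition left_Caputo ::
  "real \<Rightarrow> real \<Rightarrow> (real \<Rightarrow> real \<Rightarrow> real) \<Rightarrow> (real \<Rightarrow> real) \<Rightarrow> real \<Rightarrow> real" where
  "left_Caputo a b \<delta> x t = left_RL_integral \<delta> a (deriv_on {a..b} x) t"

definition right_Caputo ::
  "real \<Rightarrow> real \<Rightarrow> (real \<Rightarrow> real \<Rightarrow> real) \<Rightarrow> (real \<Rightarrow> real) \<Rightarrow> real \<Rightarrow> real" where
  "right_Caputo a b \<delta> x t = - right_RL_integral \<delta> b (deriv_on {a..b} x) t"

definition combined_Caputo ::
  "real \<Rightarrow> real \<Rightarrow> real \<times> real \<Rightarrow> (real \<Rightarrow> real \<Rightarrow> real) \<Rightarrow> (real \<Rightarrow> real \<Rightarrow> real) \<Rightarrow>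
   (real \<Rightarrow> real) \<Rightarrow> real \<Rightarrow> real" where
  "combined_Caputo a b \<gamma> \<alpha> \<beta> x t =
     fst \<gamma> * left_Caputo a b \<alpha> x t + snd \<gamma> * right_Caputo a b \<beta> x t"

text \<open>
  The dual derivative, applied with the pair \<open>(\<gamma>\<^sub>2, \<gamma>\<^sub>1)\<close> and the orders \<open>\<beta>, \<alpha>\<close>; its right
  part is based at \<open>T\<close>.
\<close>

definition dual_derivative ::
  "real \<Rightarrow> real \<Rightarrow> real \<Rightarrow> real \<times> real \<Rightarrow> (real \<Rightarrow> real \<Rightarrow> real) \<Rightarrow> (real \<Rightarrow> real \<Rightarrow> real) \<Rightarrow>
   (real \<Rightarrow> real) \<Rightarrow> real \<Rightarrow> real" where
  "dual_derivative a b T \<eta> \<beta> \<alpha> f t =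
     fst \<eta> * left_RL_derivative b \<beta> a f t + snd \<eta> * right_RL_derivative a \<alpha> T f t"

definition fpath ::
  "real \<Rightarrow> real \<Rightarrow> real \<times> real \<Rightarrow> (real \<Rightarrow> real \<Rightarrow> real) \<Rightarrow> (real \<Rightarrow> real \<Rightarrow> real) \<Rightarrow>
   (real \<Rightarrow> real) \<Rightarrow> real \<Rightarrow> real \<times> real \<times> real" where
  "fpath a b \<gamma> \<alpha> \<beta> x t = (t, x t, combined_Caputo a b \<gamma> \<alpha> \<beta> x t)"

definition L_d2 :: "(real \<times> real \<times> real \<Rightarrow> real) \<Rightarrow> real \<times> real \<times> real \<Rightarrow> real" where
  "L_d2 L = (\<lambda>(t, y, v). deriv (\<lambda>u. L (t, u, v)) y)"

definition L_d3 :: "(real \<times> real \<times> real \<Rightarrow> real) \<Rightarrow> real \<times> real \<times> real \<Rightarrow> real" where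
  "L_d3 L = (\<lambda>(t, y, v). deriv (\<lambda>u. L (t, y, u)) v)"

definition phi_d1 :: "real \<Rightarrow> real \<Rightarrow> (real \<times> real \<Rightarrow> real) \<Rightarrow> real \<times> real \<Rightarrow> real" where
  "phi_d1 a b \<phi> = (\<lambda>(t, y). deriv_on {a..b} (\<lambda>s. \<phi> (s, y)) t)"

definition phi_d2 :: "(real \<times> real \<Rightarrow> real) \<Rightarrow> real \<times> real \<Rightarrow> real" where
  "phi_d2 \<phi> = (\<lambda>(t, y). deriv (\<lambda>u. \<phi> (t, u)) y)"

definition C1_terminal :: "real \<Rightarrow> real \<Rightarrow> (real \<times> real \<Rightarrow> real) \<Rightarrow> bool" where
  "C1_terminal a b \<phi> \<longleftrightarrow>
     \<phi> differentiable_on ({a..b} \<times> UNIV) \<and>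
     continuous_on ({a..b} \<times> UNIV) (phi_d1 a b \<phi>) \<and>
     continuous_on ({a..b} \<times> UNIV) (phi_d2 \<phi>)"

definition D_space ::
  "real \<Rightarrow> real \<Rightarrow> real \<times> real \<Rightarrow> (real \<Rightarrow> real \<Rightarrow> real) \<Rightarrow> (real \<Rightarrow> real \<Rightarrow> real) \<Rightarrow>
   ((real \<Rightarrow> real) \<times> real) set" where
  "D_space a b \<gamma> \<alpha> \<beta> =
     {(x, t). C1_on {a..b} x \<and> t \<in> {a..b} \<and>
              continuous_on {a..b} (combined_Caputo a b \<gamma> \<alpha> \<beta> x)}"

definition D_norm ::
  "real \<Rightarrow> real \<Rightarrow> real \<times> real \<Rightarrow> (real \<Rightarrow> real \<Rightarrow> real) \<Rightarrow> (real \<Rightarrow> real \<Rightarrow> real) \<Rightarrow>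
   (real \<Rightarrow> real) \<Rightarrow> real \<Rightarrow> real" where
  "D_norm a b \<gamma> \<alpha> \<beta> x t =
     (SUP s\<in>{a..b}. \<bar>x s\<bar>) + (SUP s\<in>{a..b}. \<bar>combined_Caputo a b \<gamma> \<alpha> \<beta> x s\<bar>) + \<bar>t\<bar>"

definition J_functional ::
  "real \<Rightarrow> real \<Rightarrow> real \<times> real \<Rightarrow> (real \<Rightarrow> real \<Rightarrow> real) \<Rightarrow> (real \<Rightarrow> real \<Rightarrow> real) \<Rightarrow>
   (real \<times> real \<times> real \<Rightarrow> real) \<Rightarrow> (real \<times> real \<Rightarrow> real) \<Rightarrow> (real \<Rightarrow> real) \<Rightarrow> real \<Rightarrow> real" where
  "J_functional a b \<gamma> \<alpha> \<beta> L \<phi> x T =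
     (LINT t:{a..T}|lborel. L (fpath a b \<gamma> \<alpha> \<beta> x t)) + \<phi> (T, x T)"

definition local_minimizer ::
  "real \<Rightarrow> real \<Rightarrow> real \<times> real \<Rightarrow> (real \<Rightarrow> real \<Rightarrow> real) \<Rightarrow> (real \<Rightarrow> real \<Rightarrow> real) \<Rightarrow>
   (real \<times> real \<times> real \<Rightarrow> real) \<Rightarrow> (real \<times> real \<Rightarrow> real) \<Rightarrow> real \<Rightarrow> (real \<Rightarrow> real) \<Rightarrow> real \<Rightarrow> bool"
  where
  "local_minimizer a b \<gamma> \<alpha> \<beta> L \<phi> xa x T \<longleftrightarrow>
     (x, T) \<in> D_space a b \<gamma> \<alpha> \<beta> \<and> x a = xa \<and>
     (\<exists>\<epsilon>>0. \<forall>y S. (y, S) \<in> D_space a b \<gamma> \<alpha> \<beta> \<and> y a = xa \<and>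
        D_norm a b \<gamma> \<alpha> \<beta> (\<lambda>s. x s - y s) (T - S) < \<epsilon> \<longrightarrow>
        J_functional a b \<gamma> \<alpha> \<beta> L \<phi> x T \<le> J_functional a b \<gamma> \<alpha> \<beta> L \<phi> y S)"

end

theory Submission
  imports Defs
begin

text \<open>
  Both Caputo terms combine into one weakly singular kernel,
  \<open>D x(t) = \<integral>\<^sub>a\<^sup>b K(t,\<tau>) x'(\<tau>) d\<tau>\<close> with \<open>K = \<gamma>\<^sub>1 k\<^sub>\<alpha>(t,\<tau>) - \<gamma>\<^sub>2 k\<^sub>\<beta>(\<tau>,t)\<close>.  A kernel that is continuous off the
  diagonal and dominated by an integrable function of \<open>t - \<tau>\<close> maps continuous functions to
  continuous functions and satisfies Fubini, so every \<open>C\<^sup>1\<close> variation is admissible.  Varying in the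
  direction \<open>h(t) = \<integral>\<^sub>a\<^sup>t f\<close> and exchanging integrals, stationarity reads \<open>\<integral>\<^sub>a\<^sup>b f G = 0\<close> for all
  continuous \<open>f\<close>, where \<open>G(\<tau>) = \<integral>\<^sub>a\<^sup>T K(t,\<tau>) \<partial>\<^sub>3L(t) dt + 1\<^sub>\<tau>\<^sub>\<le>\<^sub>T (\<integral>\<^sub>\<tau>\<^sup>T \<partial>\<^sub>2L + \<partial>\<^sub>2\<phi>)\<close>.  Hence \<open>G = 0\<close> on
  both sides of \<open>T\<close>; comparing the two one-sided values at \<open>T\<close> gives \<open>\<partial>\<^sub>2\<phi>(T, x(T)) = 0\<close>, and the
  remaining conditions are read off from \<open>G = 0\<close> and from the variation of \<open>T\<close>.
\<close>

subsection \<open>Weakly singular kernels\<close>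

text \<open>
  Only values on \<open>[a,b]\<^sup>2\<close> matter; the value \<open>0\<close> on the diagonal agrees with \<open>0 powr p = 0\<close>, and it makes
  the sections of \<open>K\<close> extensions by \<open>0\<close> of functions continuous off a point, hence Borel.
\<close>

definition weakly_singular :: "real \<Rightarrow> real \<Rightarrow> (real \<Rightarrow> real \<Rightarrow> real) \<Rightarrow> bool" where
  "weakly_singular a b K \<longleftrightarrow>
     continuous_on {z \<in> {a..b} \<times> {a..b}. fst z \<noteq> snd z} (\<lambda>(t, \<tau>). K t \<tau>) \<and>
     (\<forall>t. K t t = 0) \<and>
     (\<exists>w. integrable lborel w \<and> (\<forall>s. 0 \<le> w s) \<and>
          (\<forall>t\<in>{a..b}. \<forall>\<tau>\<in>{a..b}. \<bar>K t \<tau>\<bar> \<le> w (t - \<tau>)))"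

lemma weakly_singularE:
  assumes "weakly_singular a b K"
  obtains w where "integrable lborel w" "\<And>s. 0 \<le> w s"
    "\<And>t \<tau>. t \<in> {a..b} \<Longrightarrow> \<tau> \<in> {a..b} \<Longrightarrow> \<bar>K t \<tau>\<bar> \<le> w (t - \<tau>)"
  using assms unfolding weakly_singular_def by blast

text \<open>The reflected function \<open>\<lambda>s. w (- s)\<close> dominates the transpose. There
  are two uses: the order \<beta> part of the combined kernel enters with its arguments swapped, and
  after an exchange of integrals the kernel is integrated over its first argument.\<close>

lemma weakly_singular_transpose:
  assumes "weakly_singular a b K"
  shows "weakly_singular a b (\<lambda>t \<tau>. K \<tau> t)"
proof -
  from assms obtain w where w: "integrable lborel w" "\<And>s. 0 \<le> w s"
    "\<And>t \<tau>. t \<in> {a..b} \<Longrightarrow> \<tau> \<in> {a..b} \<Longrightarrow> \<bar>K t \<tau>\<bar> \<le> w (t - \<tau>)"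
    by (rule weakly_singularE) blast
  have "integrable lborel (\<lambda>s. w (- s))"
    using lborel_integrable_real_affine[OF w(1), of "-1" 0] by simp
  moreover have "continuous_on {z \<in> {a..b} \<times> {a..b}. fst z \<noteq> snd z} (\<lambda>(t, \<tau>). K \<tau> t)"
  proof -
    have "continuous_on {z \<in> {a..b} \<times> {a..b}. fst z \<noteq> snd z} ((\<lambda>(t, \<tau>). K t \<tau>) \<circ> prod.swap)"
      using assms unfolding weakly_singular_def
      by (intro continuous_on_compose continuous_on_swap)
         (auto elim!: continuous_on_subset)
    then show ?thesis
      by (simp add: o_def case_prod_unfold)
  qed
  moreover have "\<bar>K \<tau> t\<bar> \<le> w (- (t - \<tau>))" if "t \<in> {a..b}" "\<tau> \<in> {a..b}" for t \<tau>
    using w(3)[OF that(2,1)] by simp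
  ultimately show ?thesis
    using assms w(2) unfolding weakly_singular_def by blast
qed

lemma weakly_singular_abs:
  assumes "weakly_singular a b K"
  shows "weakly_singular a b (\<lambda>t \<tau>. \<bar>K t \<tau>\<bar>)"
  using assms continuous_on_rabs[of _ "\<lambda>(t, \<tau>). K t \<tau>"] unfolding weakly_singular_def
  by (auto simp: case_prod_unfold)

lemma weakly_singular_diff:
  assumes "weakly_singular a b K" "weakly_singular a b K'"
  shows "weakly_singular a b (\<lambda>t \<tau>. c * K t \<tau> - c' * K' t \<tau>)"
proof -
  from assms(1) obtain w where w: "integrable lborel w" "\<And>s. 0 \<le> w s"
    "\<And>t \<tau>. t \<in> {a..b} \<Longrightarrow> \<tau> \<in> {a..b} \<Longrightarrow> \<bar>K t \<tau>\<bar> \<le> w (t - \<tau>)"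
    by (rule weakly_singularE) blast
  from assms(2) obtain w' where w': "integrable lborel w'" "\<And>s. 0 \<le> w' s"
    "\<And>t \<tau>. t \<in> {a..b} \<Longrightarrow> \<tau> \<in> {a..b} \<Longrightarrow> \<bar>K' t \<tau>\<bar> \<le> w' (t - \<tau>)"
    by (rule weakly_singularE) blast
  define v where "v = (\<lambda>s. \<bar>c\<bar> * w s + \<bar>c'\<bar> * w' s)"
  have "integrable lborel v" "\<And>s. 0 \<le> v s"
    using w w' by (auto simp: v_def)
  moreover have "\<bar>c * K t \<tau> - c' * K' t \<tau>\<bar> \<le> v (t - \<tau>)" if "t \<in> {a..b}" "\<tau> \<in> {a..b}" for t \<tau>
  proof -
    have "\<bar>c * K t \<tau> - c' * K' t \<tau>\<bar> \<le> \<bar>c\<bar> * \<bar>K t \<tau>\<bar> + \<bar>c'\<bar> * \<bar>K' t \<tau>\<bar>"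
      using abs_triangle_ineq4[of "c * K t \<tau>" "c' * K' t \<tau>"] by (simp add: abs_mult)
    also have "\<dots> \<le> v (t - \<tau>)"
      unfolding v_def using w(3)[OF that] w'(3)[OF that] by (intro add_mono mult_left_mono) auto
    finally show ?thesis .
  qed
  moreover have "continuous_on {z \<in> {a..b} \<times> {a..b}. fst z \<noteq> snd z}
      (\<lambda>(t, \<tau>). c * K t \<tau> - c' * K' t \<tau>)"
    using assms unfolding weakly_singular_def
    by (auto simp: case_prod_unfold intro!: continuous_intros)
  moreover have "\<forall>t. c * K t t - c' * K' t t = 0"
    using assms unfolding weakly_singular_def by simp
  ultimately show ?thesis
    unfolding weakly_singular_def by blast
qed

text \<open>Measurability comes from continuity off the single point \<open>t\<close>; since
  \<open>K t t = 0\<close>, putting that point back does not change the integrand. With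
  \<open>f\<close> bounded by \<open>B\<close>, the integrand is dominated by
  \<open>B * w (t - \<tau>)\<close>, a reflected translate of an integrable function.\<close>

lemma weakly_singular_integrable:
  assumes K: "weakly_singular a b K" and t: "t \<in> {a..b}"
    and uv: "{u..v} \<subseteq> {a..b}" and f: "continuous_on {u..v} f"
  shows "set_integrable lborel {u..v} (\<lambda>\<tau>. K t \<tau> * f \<tau>)"
proof -
  from K obtain w where w: "integrable lborel w" "\<And>s. 0 \<le> w s"
    "\<And>t \<tau>. t \<in> {a..b} \<Longrightarrow> \<tau> \<in> {a..b} \<Longrightarrow> \<bar>K t \<tau>\<bar> \<le> w (t - \<tau>)"
    by (rule weakly_singularE) blast
  have "bounded (f ` {u..v})"
    by (intro compact_imp_bounded compact_continuous_image f) auto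
  then obtain B where B: "B > 0" "\<And>s. s \<in> {u..v} \<Longrightarrow> \<bar>f s\<bar> \<le> B"
    unfolding bounded_pos by auto
  have int: "integrable lborel (\<lambda>\<tau>. B * w (t - \<tau>))"
    using lborel_integrable_real_affine[OF w(1), of "-1" t] by simp
  have "continuous_on ({u..v} - {t}) (\<lambda>\<tau>. (\<lambda>(t, \<tau>). K t \<tau>) (t, \<tau>))"
    using uv t
    by (intro continuous_on_compose2[OF conjunct1[OF K[unfolded weakly_singular_def]]] continuous_intros) auto
  then have "continuous_on ({u..v} - {t}) (\<lambda>\<tau>. K t \<tau> * f \<tau>)"
    by (auto intro!: continuous_intros continuous_on_subset[OF f])
  then have "(\<lambda>\<tau>. indicator ({u..v} - {t}) \<tau> *\<^sub>R (K t \<tau> * f \<tau>)) \<in> borel_measurable borel"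
    by (intro borel_measurable_continuous_on_indicator) auto
  also have "(\<lambda>\<tau>. indicator ({u..v} - {t}) \<tau> *\<^sub>R (K t \<tau> * f \<tau>)) =
      (\<lambda>\<tau>. indicator {u..v} \<tau> *\<^sub>R (K t \<tau> * f \<tau>))"
    using K by (auto simp: weakly_singular_def indicator_def fun_eq_iff)
  finally have meas: "(\<lambda>\<tau>. indicator {u..v} \<tau> *\<^sub>R (K t \<tau> * f \<tau>)) \<in> borel_measurable borel" .
  show ?thesis
    unfolding set_integrable_def
  proof (rule Bochner_Integration.integrable_bound[OF int])
    have "\<bar>indicator {u..v} \<tau> *\<^sub>R (K t \<tau> * f \<tau>)\<bar> \<le> B * w (t - \<tau>)" for \<tau>
    proof (cases "\<tau> \<in> {u..v}")
      case True
      then have "\<bar>K t \<tau>\<bar> * \<bar>f \<tau>\<bar> \<le> w (t - \<tau>) * B"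
        using w(2,3) B t uv by (intro mult_mono) auto
      then show ?thesis using True by (simp add: abs_mult mult.commute)
    next
      case False
      then show ?thesis using w(2) B by simp
    qed
    then show "AE \<tau> in lborel. norm (indicator {u..v} \<tau> *\<^sub>R (K t \<tau> * f \<tau>)) \<le> norm (B * w (t - \<tau>))"
      using w(2) B by (auto simp: abs_mult)
  qed (use meas in simp)
qed

text \<open>The substitution \<tau> = t + s moves the singularity to the fixed place s = 0. One
  function, \<open>B * w (- s)\<close>, then dominates the integrands for all \<open>t\<close> at
  once, and dominated convergence along sequences applies.\<close>

lemma weakly_singular_continuous:
  assumes K: "weakly_singular a b K"
    and uv: "{u..v} \<subseteq> {a..b}" and f: "continuous_on {u..v} f"
  shows "continuous_on {a..b} (\<lambda>t. LINT \<tau>:{u..v}|lborel. K t \<tau> * f \<tau>)"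
proof -
  from K obtain w where w: "integrable lborel w" "\<And>s. 0 \<le> w s"
    "\<And>t \<tau>. t \<in> {a..b} \<Longrightarrow> \<tau> \<in> {a..b} \<Longrightarrow> \<bar>K t \<tau>\<bar> \<le> w (t - \<tau>)"
    by (rule weakly_singularE) blast
  have "bounded (f ` {u..v})"
    by (intro compact_imp_bounded compact_continuous_image f) auto
  then obtain B where B: "B > 0" "\<And>s. s \<in> {u..v} \<Longrightarrow> \<bar>f s\<bar> \<le> B"
    unfolding bounded_pos by auto
  define F where "F = (\<lambda>t s. indicator {u..v} (t + s) *\<^sub>R (K t (t + s) * f (t + s)))"
  have eq: "(LINT \<tau>:{u..v}|lborel. K t \<tau> * f \<tau>) = integral\<^sup>L lborel (F t)" for t
    unfolding set_lebesgue_integral_def F_def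
    by (subst lborel_integral_real_affine[where c = 1 and t = t]) auto
  have meas: "F t \<in> borel_measurable lborel" if "t \<in> {a..b}" for t
    unfolding F_def
    using lborel_integrable_real_affine[of "\<lambda>\<tau>. indicator {u..v} \<tau> *\<^sub>R (K t \<tau> * f \<tau>)" 1 t]
      weakly_singular_integrable[OF K that uv f]
    by (auto simp: set_integrable_def dest: borel_measurable_integrable)
  have int: "integrable lborel (\<lambda>s. B * w (- s))"
    using lborel_integrable_real_affine[OF w(1), of "-1" 0] by simp
  have bound: "norm (F t s) \<le> B * w (- s)" if "t \<in> {a..b}" for t s
  proof (cases "t + s \<in> {u..v}")
    case True
    then have "\<bar>K t (t + s)\<bar> * \<bar>f (t + s)\<bar> \<le> w (t - (t + s)) * B"
      using w(2) w(3)[OF that, of "t + s"] B True uv by (intro mult_mono) auto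
    then show ?thesis using True by (simp add: F_def abs_mult mult.commute)
  next
    case False
    then show ?thesis using w(2) B by (simp add: F_def)
  qed
  \<comment> \<open>The excluded values are the singularity and the two places where
    \<open>t + s\<close> hits an endpoint of the interval, at which the indicator may jump; they
    form a null set. Elsewhere \<open>t + s\<close> lies in the interior, where \<open>K\<close> and
    \<open>f\<close> are continuous, or off the interval, where \<open>F (X n) s\<close> is
    eventually 0.\<close>
  have lim: "(\<lambda>n. F (X n) s) \<longlonglongrightarrow> F t s"
    if X: "\<And>n. X n \<in> {a..b}" "X \<longlonglongrightarrow> t" and t: "t \<in> {a..b}"
      and s: "s \<noteq> 0" "s \<noteq> u - t" "s \<noteq> v - t" for X t s
  proof (cases "u < t + s \<and> t + s < v")
    case True
    have "(\<lambda>n. X n + s) \<longlonglongrightarrow> t + s"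
      using X by (intro tendsto_intros)
    then have ev: "eventually (\<lambda>n. X n + s \<in> {u<..<v}) sequentially"
      using True by (intro topological_tendstoD) auto
    let ?S = "{z \<in> {a..b} \<times> {u..v}. fst z \<noteq> snd z}"
    have "continuous_on ?S (\<lambda>z. (\<lambda>(t, \<tau>). K t \<tau>) z * f (snd z))"
    proof (intro continuous_intros)
      show "continuous_on ?S (\<lambda>(t, \<tau>). K t \<tau>)"
        using K uv unfolding weakly_singular_def by (auto elim!: continuous_on_subset)
      show "continuous_on ?S (\<lambda>z. f (snd z))"
        by (intro continuous_on_compose2[OF f] continuous_intros) auto
    qed
    then have "((\<lambda>n. (\<lambda>z. (\<lambda>(t, \<tau>). K t \<tau>) z * f (snd z)) (X n, X n + s)) \<longlongrightarrow>
        (\<lambda>z. (\<lambda>(t, \<tau>). K t \<tau>) z * f (snd z)) (t, t + s)) sequentially"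
      apply (rule continuous_on_tendsto_compose)
      subgoal using X by (intro tendsto_intros)
      subgoal using True s t uv by auto
      subgoal using ev X s by (auto elim!: eventually_mono)
      done
    then have "(\<lambda>n. K (X n) (X n + s) * f (X n + s)) \<longlonglongrightarrow> K t (t + s) * f (t + s)"
      by simp
    then show ?thesis
      by (rule Lim_transform_eventually[THEN tendsto_eq_rhs])
         (use ev True in \<open>auto simp: F_def elim!: eventually_mono\<close>)
  next
    case False
    have "(\<lambda>n. X n + s) \<longlonglongrightarrow> t + s"
      using X by (intro tendsto_intros)
    then have ev: "eventually (\<lambda>n. X n + s \<in> - {u..v}) sequentially"
      using False s by (intro topological_tendstoD) auto
    have "F t s = 0" using False s by (auto simp: F_def indicator_def)
    then show ?thesis
      by (intro tendsto_eventually) (use ev in \<open>auto simp: F_def elim!: eventually_mono\<close>)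
  qed
  show ?thesis
    unfolding continuous_on_sequentially eq o_def
  proof (intro allI ballI impI)
    fix X t assume t: "t \<in> {a..b}" and X: "(\<forall>n. X n \<in> {a..b}) \<and> X \<longlonglongrightarrow> t"
    show "(\<lambda>n. integral\<^sup>L lborel (F (X n))) \<longlonglongrightarrow> integral\<^sup>L lborel (F t)"
    proof (rule integral_dominated_convergence[OF _ _ int])
      show "AE s in lborel. (\<lambda>n. F (X n) s) \<longlonglongrightarrow> F t s"
        using AE_lborel_singleton[of 0] AE_lborel_singleton[of "u - t"] AE_lborel_singleton[of "v - t"]
        by eventually_elim (use lim t X in auto)
    qed (use t X meas bound in auto)
  qed
qed

text \<open>Absolute integrability of the product integrand \<open>H\<close> is the point. Its inner
  integral of absolute values is a continuous function of \<open>t\<close>, by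
  \<open>weakly_singular_continuous\<close> applied to the weakly singular kernel \<bar>K\<bar>,
  hence integrable over a compact interval. Measurability again uses that \<open>H\<close> vanishes
  on the diagonal and is continuous on the rectangle without it.\<close>

lemma weakly_singular_Fubini:
  assumes K: "weakly_singular a b K"
    and uv: "{u..v} \<subseteq> {a..b}" and f: "continuous_on {a..b} f" and g: "continuous_on {a..b} g"
  shows "(LINT t:{u..v}|lborel. g t * (LINT \<tau>:{a..b}|lborel. K t \<tau> * f \<tau>)) =
         (LINT \<tau>:{a..b}|lborel. f \<tau> * (LINT t:{u..v}|lborel. K t \<tau> * g t))"
proof -
  define H where "H = (\<lambda>(t, \<tau>). indicator {u..v} t * indicator {a..b} \<tau> * (g t * (K t \<tau> * f \<tau>)))"
  let ?S = "{z \<in> {u..v} \<times> {a..b}. fst z \<noteq> snd z}"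
  have "continuous_on ?S (\<lambda>z. g (fst z) * ((\<lambda>(t, \<tau>). K t \<tau>) z * f (snd z)))"
  proof (intro continuous_intros)
    show "continuous_on ?S (\<lambda>(t, \<tau>). K t \<tau>)"
      using K uv unfolding weakly_singular_def by (auto elim!: continuous_on_subset)
    show "continuous_on ?S (\<lambda>z. f (snd z))"
      by (intro continuous_on_compose2[OF f] continuous_intros) auto
    show "continuous_on ?S (\<lambda>z. g (fst z))"
      using uv by (intro continuous_on_compose2[OF g] continuous_intros) auto
  qed
  moreover have "?S \<in> sets borel"
  proof -
    have "?S = ({u..v} \<times> {a..b}) \<inter> {z. fst z \<noteq> snd z}" by auto
    moreover have "open {z :: real \<times> real. fst z \<noteq> snd z}"
      by (intro open_Collect_neq continuous_intros)
    moreover have "closed ({u..v} \<times> {a..b})"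
      by (intro closed_Times) auto
    ultimately show ?thesis by auto
  qed
  ultimately have "(\<lambda>z. indicator ?S z *\<^sub>R (g (fst z) * ((\<lambda>(t, \<tau>). K t \<tau>) z * f (snd z)))) \<in> borel_measurable borel"
    by (intro borel_measurable_continuous_on_indicator)
  also have "(\<lambda>z. indicator ?S z *\<^sub>R (g (fst z) * ((\<lambda>(t, \<tau>). K t \<tau>) z * f (snd z)))) = H"
    using K by (auto simp: weakly_singular_def indicator_def fun_eq_iff H_def)
  finally have meas: "H \<in> borel_measurable (lborel \<Otimes>\<^sub>M lborel)"
    by (simp add: lborel_prod)
  have inner: "(\<lambda>\<tau>. H (t, \<tau>)) = (\<lambda>\<tau>. (indicator {u..v} t * g t) * (indicator {a..b} \<tau> *\<^sub>R (K t \<tau> * f \<tau>)))" for t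
    by (auto simp: H_def fun_eq_iff)
  have inner': "(\<lambda>t. H (t, \<tau>)) = (\<lambda>t. (indicator {a..b} \<tau> * f \<tau>) * (indicator {u..v} t *\<^sub>R (K t \<tau> * g t)))" for \<tau>
    by (auto simp: H_def fun_eq_iff)
  have int: "integrable (lborel \<Otimes>\<^sub>M lborel) H"
  proof (rule lborel_pair.Fubini_integrable[OF meas])
    have "integrable lborel (\<lambda>\<tau>. H (t, \<tau>))" for t
    proof (cases "t \<in> {u..v}")
      case True
      then have "set_integrable lborel {a..b} (\<lambda>\<tau>. K t \<tau> * f \<tau>)"
        using uv by (intro weakly_singular_integrable[OF K _ _ f]) auto
      then show ?thesis unfolding inner set_integrable_def
        by (rule integrable_mult_right)
    qed (simp add: H_def)
    then show "AE t in lborel. integrable lborel (\<lambda>\<tau>. H (t, \<tau>))" by simp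
    have "norm (H (t, \<tau>)) = (indicator {u..v} t * \<bar>g t\<bar>) * (indicator {a..b} \<tau> *\<^sub>R (\<bar>K t \<tau>\<bar> * \<bar>f \<tau>\<bar>))" for t \<tau>
      by (simp add: H_def abs_mult)
    then have "(\<lambda>t. LINT \<tau>|lborel. norm (H (t, \<tau>))) =
       (\<lambda>t. indicator {u..v} t *\<^sub>R (\<bar>g t\<bar> * (LINT \<tau>:{a..b}|lborel. \<bar>K t \<tau>\<bar> * \<bar>f \<tau>\<bar>)))"
      by (simp add: set_lebesgue_integral_def mult.assoc)
    moreover have "set_integrable lborel {u..v} (\<lambda>t. \<bar>g t\<bar> * (LINT \<tau>:{a..b}|lborel. \<bar>K t \<tau>\<bar> * \<bar>f \<tau>\<bar>))"
      by (rule borel_integrable_atLeastAtMost'[OF continuous_on_subset[OF _ uv]], intro continuous_intros g f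
           weakly_singular_continuous weakly_singular_abs[OF K]) auto
    ultimately show "integrable lborel (\<lambda>t. LINT \<tau>|lborel. norm (H (t, \<tau>)))"
      unfolding set_integrable_def by simp
  qed
  have "(LINT \<tau>|lborel. LINT t|lborel. H (t, \<tau>)) = (LINT t|lborel. LINT \<tau>|lborel. H (t, \<tau>))"
    using lborel_pair.Fubini_integral[of "\<lambda>t \<tau>. H (t, \<tau>)"] int by simp
  then show ?thesis
    unfolding inner inner' set_lebesgue_integral_def by (simp add: mult.assoc)
qed

section \<open>Riemann-Liouville integrals as weakly singular kernel operators\<close>

definition RL_kernel :: "(real \<Rightarrow> real \<Rightarrow> real) \<Rightarrow> real \<Rightarrow> real \<Rightarrow> real" where
  "RL_kernel \<delta> t \<tau> = (if \<tau> < t then (t - \<tau>) powr (- \<delta> t \<tau>) / Gamma (1 - \<delta> t \<tau>) else 0)"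

text \<open>The extension of the kernel by 0 absorbs the variable endpoint \<open>t\<close>, so the
  integral can be taken over any fixed interval reaching at least to \<open>t\<close>. On the
  diagonal the two integrands agree because \<open>0 powr p = 0\<close>.\<close>

lemma left_RL_integral_kernel:
  assumes "t \<le> v"
  shows "left_RL_integral \<delta> c f t = (LINT \<tau>:{c..v}|lborel. RL_kernel \<delta> t \<tau> * f \<tau>)"
  unfolding left_RL_integral_def set_lebesgue_integral_def
  by (rule Bochner_Integration.integral_cong) (use assms in \<open>auto simp: RL_kernel_def indicator_def\<close>)

lemma right_RL_integral_kernel:
  assumes "u \<le> t"
  shows "right_RL_integral \<delta> c f t = (LINT \<tau>:{u..c}|lborel. RL_kernel \<delta> \<tau> t * f \<tau>)"
  unfolding right_RL_integral_def set_lebesgue_integral_def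
  by (rule Bochner_Integration.integral_cong) (use assms in \<open>auto simp: RL_kernel_def indicator_def\<close>)

text \<open>By compactness \<delta> has a maximum \<open>M\<close> below 1 and the reciprocal of the
  Gamma factor is bounded by some \<open>B\<close>. Up to a constant the kernel is therefore
  dominated by \<open>s powr (- M)\<close> with s = t - \<tau>, which is integrable at 0.\<close>

lemma weakly_singular_RL_kernel:
  assumes ab: "a \<le> b"
    and cont: "continuous_on ({a..b} \<times> {a..b}) (\<lambda>(t, \<tau>). \<delta> t \<tau>)"
    and \<delta>: "\<And>t \<tau>. t \<in> {a..b} \<Longrightarrow> \<tau> \<in> {a..b} \<Longrightarrow> \<delta> t \<tau> \<in> {0<..<1}"
  shows "weakly_singular a b (RL_kernel \<delta>)"
proof -
  let ?Q = "{a..b} \<times> {a..b}"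
  have Q: "compact ?Q" "?Q \<noteq> {}" using ab by (auto intro: compact_Times)
  obtain z where z: "z \<in> ?Q" and zmax: "\<And>y. y \<in> ?Q \<Longrightarrow> (\<lambda>(t, \<tau>). \<delta> t \<tau>) y \<le> (\<lambda>(t, \<tau>). \<delta> t \<tau>) z"
    using continuous_attains_sup[OF Q cont] by blast
  define M where "M = (\<lambda>(t, \<tau>). \<delta> t \<tau>) z"
  have M: "0 < M" "M < 1" using \<delta>[of "fst z" "snd z"] z by (auto simp: M_def case_prod_unfold)
  have \<delta>M: "\<delta> t \<tau> \<le> M" if "t \<in> {a..b}" "\<tau> \<in> {a..b}" for t \<tau>
    using zmax[of "(t, \<tau>)"] that by (simp add: M_def)
  have G: "continuous_on ?Q (\<lambda>z. Gamma (1 - (\<lambda>(t, \<tau>). \<delta> t \<tau>) z))"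
    using \<delta> by (intro continuous_on_compose2[OF continuous_on_Gamma[of "{0<..}"]] continuous_intros cont)
      (auto dest: nonpos_Ints_nonpos)
  have Gpos: "Gamma (1 - \<delta> t \<tau>) > 0" if "t \<in> {a..b}" "\<tau> \<in> {a..b}" for t \<tau>
    using \<delta>[OF that] by (intro Gamma_real_pos) auto
  have Gne: "Gamma (1 - (\<lambda>(t, \<tau>). \<delta> t \<tau>) z) \<noteq> 0" if "z \<in> ?Q" for z
    using Gpos[of "fst z" "snd z"] that by (auto simp: case_prod_unfold)
  have "continuous_on ?Q (\<lambda>z. inverse (Gamma (1 - (\<lambda>(t, \<tau>). \<delta> t \<tau>) z)))"
    using G Gne by (intro continuous_on_inverse) auto
  then have "bounded ((\<lambda>z. inverse (Gamma (1 - (\<lambda>(t, \<tau>). \<delta> t \<tau>) z))) ` ?Q)"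
    by (intro compact_imp_bounded compact_continuous_image Q)
  then obtain B where B: "B > 0"
    and Bz: "\<And>z. z \<in> ?Q \<Longrightarrow> norm (inverse (Gamma (1 - (\<lambda>(t, \<tau>). \<delta> t \<tau>) z))) \<le> B"
    unfolding bounded_pos by blast
  have B': "inverse (Gamma (1 - \<delta> t \<tau>)) \<le> B" if "t \<in> {a..b}" "\<tau> \<in> {a..b}" for t \<tau>
    using Bz[of "(t, \<tau>)"] Gpos[OF that] that by simp
  \<comment> \<open>The factor \<open>l\<close> pays for replacing the exponent
    \<open>- \<delta> t \<tau>\<close> by \<open>- M\<close>: the quotient is
    \<open>s powr (M - \<delta> t \<tau>)\<close> with exponent between 0 and 1, and
    \<open>s \<le> l\<close> with \<open>1 \<le> l\<close> bounds it by \<open>l\<close>.\<close>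
  define l where "l = max 1 (b - a)"
  define w where "w = (\<lambda>s. indicator {0..b - a} s *\<^sub>R (l * B * (s powr (- M))))"
  have "integrable lborel w"
  proof -
    have "(\<lambda>s. s powr (-M)) integrable_on {0..b - a}"
      using M ab by (intro integrable_on_powr_from_0) auto
    then have "set_integrable lebesgue {0..b - a} (\<lambda>s. s powr (-M))"
      by (intro nonnegative_absolutely_integrable_1) auto
    then have "integrable lborel (\<lambda>s. indicator {0..b - a} s *\<^sub>R (s powr (-M)))"
      unfolding set_integrable_def
      by (subst (asm) integrable_completion) auto
    then show ?thesis
      unfolding w_def by (simp add: mult.left_commute[of "indicator _ _"])
  qed
  moreover have "\<forall>s. 0 \<le> w s" using B by (auto simp: w_def l_def)
  moreover have "\<bar>RL_kernel \<delta> t \<tau>\<bar> \<le> w (t - \<tau>)" if t: "t \<in> {a..b}" and \<tau>: "\<tau> \<in> {a..b}" for t \<tau>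
  proof (cases "\<tau> < t")
    case True
    let ?s = "t - \<tau>"
    have s: "0 < ?s" "?s \<le> l" "1 \<le> l" using True t \<tau> by (auto simp: l_def)
    have d: "0 < \<delta> t \<tau>" "\<delta> t \<tau> \<le> M" using \<delta>[OF t \<tau>] \<delta>M[OF t \<tau>] by auto
    have "?s powr (- \<delta> t \<tau>) = ?s powr (M - \<delta> t \<tau>) * ?s powr (- M)"
      by (simp add: powr_add[symmetric])
    also have "?s powr (M - \<delta> t \<tau>) \<le> l powr (M - \<delta> t \<tau>)"
      using s d by (intro powr_mono2) auto
    also have "l powr (M - \<delta> t \<tau>) \<le> l powr 1"
      using s d M by (intro powr_mono) auto
    finally have "?s powr (- \<delta> t \<tau>) \<le> l * ?s powr (- M)"
      using s by (simp add: mult_right_mono)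
    then have "?s powr (- \<delta> t \<tau>) * inverse (Gamma (1 - \<delta> t \<tau>)) \<le> (l * ?s powr (- M)) * B"
      using B'[OF t \<tau>] Gpos[OF t \<tau>] s by (intro mult_mono) auto
    moreover have "\<bar>RL_kernel \<delta> t \<tau>\<bar> = ?s powr (- \<delta> t \<tau>) * inverse (Gamma (1 - \<delta> t \<tau>))"
      using True Gpos[OF t \<tau>] by (simp add: RL_kernel_def divide_inverse)
    ultimately show ?thesis
      using True t \<tau> by (simp add: w_def mult_ac)
  next
    case False
    then show ?thesis using B by (auto simp: RL_kernel_def w_def l_def)
  qed
  moreover have "continuous_on {z \<in> ?Q. fst z \<noteq> snd z} (\<lambda>(t, \<tau>). RL_kernel \<delta> t \<tau>)"
  proof -
    \<comment> \<open>Off the diagonal the square splits into two relatively open parts. On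
      \<open>U\<close> the kernel is given by the power formula, with positive base, and on
      \<open>V\<close> it is 0.\<close>
    define U where "U = {z :: real \<times> real. snd z < fst z}"
    define V where "V = {z :: real \<times> real. fst z < snd z}"
    have op: "open U" "open V"
      unfolding U_def V_def by (intro open_Collect_less continuous_intros)+
    have "continuous_on (?Q \<inter> U)
       (\<lambda>z. (fst z - snd z) powr (- (\<lambda>(t, \<tau>). \<delta> t \<tau>) z) / Gamma (1 - (\<lambda>(t, \<tau>). \<delta> t \<tau>) z))"
      using Gne by (intro continuous_intros continuous_on_subset[OF cont] continuous_on_subset[OF G])
        (auto simp: U_def)
    then have 1: "continuous_on (?Q \<inter> U) (\<lambda>(t, \<tau>). RL_kernel \<delta> t \<tau>)"
      by (rule continuous_on_eq) (auto simp: RL_kernel_def U_def)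
    have 2: "continuous_on (?Q \<inter> V) (\<lambda>(t, \<tau>). RL_kernel \<delta> t \<tau>)"
      by (rule continuous_on_eq[of _ "\<lambda>_. 0"]) (auto simp: RL_kernel_def V_def)
    have eq: "{z \<in> ?Q. fst z \<noteq> snd z} = (?Q \<inter> U) \<union> (?Q \<inter> V)"
      by (auto simp: U_def V_def)
    show ?thesis
      unfolding eq
    proof (rule continuous_on_Un_local_open[OF _ _ 1 2])
      show "openin (top_of_set (?Q \<inter> U \<union> ?Q \<inter> V)) (?Q \<inter> U)"
        unfolding openin_open by (rule exI[of _ U]) (use op in \<open>auto simp: U_def V_def\<close>)
      show "openin (top_of_set (?Q \<inter> U \<union> ?Q \<inter> V)) (?Q \<inter> V)"
        unfolding openin_open by (rule exI[of _ V]) (use op in \<open>auto simp: U_def V_def\<close>)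
    qed
  qed
  moreover have "\<forall>t. RL_kernel \<delta> t t = 0" by (simp add: RL_kernel_def)
  ultimately show ?thesis
    unfolding weakly_singular_def by blast
qed

text \<open>Only the point \<open>c\<close> contributes, and there the integrand is 0 because
  \<open>0 powr p = 0\<close>. This makes the brackets at t = T in the first two transversality
  conditions vanish.\<close>

lemma RL_integral_at_base:
  "left_RL_integral \<delta> c f c = 0" "right_RL_integral \<delta> c f c = 0"
  unfolding left_RL_integral_def right_RL_integral_def set_lebesgue_integral_def
  by (rule trans[OF Bochner_Integration.integral_cong[where g = "\<lambda>_. 0"]]; auto simp: indicator_def)+

subsection \<open>Derivatives along curves and a fundamental lemma\<close>

text \<open>The chain rule relative to \<open>S\<close> handles boundary points of the slab
  \<open>{a..b} \<times> UNIV\<close>, where only a derivative within the slab is given: the curves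
  used below stay inside it.\<close>

lemma has_real_derivative_along_curve:
  fixes F :: "'a::real_normed_vector \<Rightarrow> real"
  assumes "(F has_derivative D) (at (c s) within S)"
    and "(c has_vector_derivative c') (at s within I)" and "c ` I \<subseteq> S"
  shows "((\<lambda>s. F (c s)) has_real_derivative D c') (at s within I)"
  using vector_derivative_diff_chain_within[OF assms(2) has_derivative_subset[OF assms(1,3)]]
  by (simp add: has_real_derivative_iff_has_vector_derivative o_def)

lemma has_real_derivative_L_line:
  fixes t h w :: real
  assumes L: "L differentiable_on ({a..b} \<times> UNIV)" and t: "t \<in> {a..b}"
  shows "((\<lambda>e. L (t, y + e * h, v + e * w)) has_real_derivative
           L_d2 L (t, y + e * h, v + e * w) * h + L_d3 L (t, y + e * h, v + e * w) * w) (at e)"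
proof -
  let ?p = "(t, y + e * h, v + e * w)" and ?S = "{a..b} \<times> UNIV"
  obtain D where D: "(L has_derivative D) (at ?p within ?S)"
    using bspec[OF L[unfolded differentiable_on_def], of ?p] t unfolding differentiable_def by auto
  \<comment> \<open>The line passes through \<open>?p\<close> at s = r. With r = y + e * h and
    direction (1, 0) its second coordinate is s itself, which gives the partial derivative
    \<open>L_d2\<close>; likewise r = v + e * w gives \<open>L_d3\<close>, and r = e with direction
    (h, w) gives the claim.\<close>
  have line: "((\<lambda>s. L (t, y + e * h + (s - r) * h', v + e * w + (s - r) * w')) has_real_derivative D (0, h', w')) (at r)"
    for r h' w'
    by (rule has_real_derivative_along_curve[where S = ?S])
       (use D t in \<open>auto intro!: derivative_eq_intros has_vector_derivative_Pair
          simp flip: has_real_derivative_iff_has_vector_derivative\<close>)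
  have "deriv (\<lambda>u. L (t, u, v + e * w)) (y + e * h) = D (0, 1, 0)"
    using line[of "y + e * h" 1 0] by (intro DERIV_imp_deriv) simp
  moreover have "deriv (\<lambda>u. L (t, y + e * h, u)) (v + e * w) = D (0, 0, 1)"
    using line[of "v + e * w" 0 1] by (intro DERIV_imp_deriv) simp
  moreover have "D (0, h, w) = D (0, 1, 0) * h + D (0, 0, 1) * w"
  proof -
    interpret bounded_linear D by (rule has_derivative_bounded_linear[OF D])
    have "(0, h, w) = h *\<^sub>R (0, 1, 0) + w *\<^sub>R ((0, 0, 1) :: real \<times> real \<times> real)" by simp
    then have "D (0, h, w) = h *\<^sub>R D (0, 1, 0) + w *\<^sub>R D (0, 0, 1)"
      by (simp only: add scale)
    then show ?thesis by simp
  qed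
  ultimately show ?thesis
    using line[of e h w]
    by (simp add: L_d2_def L_d3_def algebra_simps)
qed

lemma has_real_derivative_phi_d2:
  assumes \<phi>: "\<phi> differentiable_on ({a..b} \<times> UNIV)" and t: "t \<in> {a..b}"
  shows "((\<lambda>u. \<phi> (t, u)) has_real_derivative phi_d2 \<phi> (t, y)) (at y)"
proof -
  obtain D where D: "(\<phi> has_derivative D) (at (t, y) within {a..b} \<times> UNIV)"
    using bspec[OF \<phi>[unfolded differentiable_on_def], of "(t, y)"] t unfolding differentiable_def by auto
  have "((\<lambda>u. \<phi> (t, u)) has_real_derivative D (0, 1)) (at y)"
    by (rule has_real_derivative_along_curve[where S = "{a..b} \<times> UNIV"])
       (use D t in \<open>auto intro!: derivative_eq_intros has_vector_derivative_Pair
          simp flip: has_real_derivative_iff_has_vector_derivative\<close>)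
  then show ?thesis
    by (simp add: phi_d2_def DERIV_imp_deriv)
qed

lemma has_real_derivative_phi_graph:
  assumes ab: "a < b" and \<phi>: "\<phi> differentiable_on ({a..b} \<times> UNIV)" and t: "t \<in> {a..b}"
    and x: "(x has_real_derivative x') (at t within {a..b})"
  shows "((\<lambda>s. \<phi> (s, x s)) has_real_derivative phi_d1 a b \<phi> (t, x t) + phi_d2 \<phi> (t, x t) * x')
           (at t within {a..b})"
proof -
  obtain D where D: "(\<phi> has_derivative D) (at (t, x t) within {a..b} \<times> UNIV)"
    using bspec[OF \<phi>[unfolded differentiable_on_def], of "(t, x t)"] t unfolding differentiable_def by auto
  have "((\<lambda>s. \<phi> (s, x t)) has_real_derivative D (1, 0)) (at t within {a..b})"
    by (rule has_real_derivative_along_curve[where S = "{a..b} \<times> UNIV"])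
       (use D t in \<open>auto intro!: derivative_eq_intros has_vector_derivative_Pair
          simp flip: has_real_derivative_iff_has_vector_derivative\<close>)
  then have 1: "phi_d1 a b \<phi> (t, x t) = D (1, 0)"
    using ab t by (simp add: phi_d1_def vector_derivative_within_closed_interval
        has_real_derivative_iff_has_vector_derivative)
  have "((\<lambda>u. \<phi> (t, u)) has_real_derivative D (0, 1)) (at (x t))"
    by (rule has_real_derivative_along_curve[where S = "{a..b} \<times> UNIV"])
       (use D t in \<open>auto intro!: derivative_eq_intros has_vector_derivative_Pair
          simp flip: has_real_derivative_iff_has_vector_derivative\<close>)
  then have 2: "phi_d2 \<phi> (t, x t) = D (0, 1)"
    by (simp add: phi_d2_def DERIV_imp_deriv)
  have "((\<lambda>s. \<phi> (s, x s)) has_real_derivative D (1, x')) (at t within {a..b})"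
    by (rule has_real_derivative_along_curve[where S = "{a..b} \<times> UNIV"])
       (use D t x in \<open>auto intro!: derivative_eq_intros has_vector_derivative_Pair
          simp flip: has_real_derivative_iff_has_vector_derivative\<close>)
  moreover have "D (1, x') = D (1, 0) + D (0, 1) * x'"
  proof -
    interpret bounded_linear D by (rule has_derivative_bounded_linear[OF D])
    have "(1, x') = (1, 0) + x' *\<^sub>R ((0, 1) :: real \<times> real)" by simp
    then have "D (1, x') = D (1, 0) + x' *\<^sub>R D (0, 1)"
      by (simp only: add scale)
    then show ?thesis by simp
  qed
  ultimately show ?thesis by (simp add: 1 2)
qed

text \<open>A continuous nonnegative integrand with integral 0 vanishes identically. The weight is
  positive on the open interval, so \<open>F\<close> is 0 there, and continuity carries this to both
  endpoints, including the zero \<open>T\<close> of the weight.\<close>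

lemma weighted_square_integral_eq_0:
  fixes F :: "real \<Rightarrow> real"
  assumes F: "continuous_on {u..v} F" and uv: "u < v" and T: "T = u \<or> T = v"
    and int: "integral {u..v} (\<lambda>s. \<bar>s - T\<bar> * (F s)\<^sup>2) = 0" and s: "s \<in> {u..v}"
  shows "F s = 0"
proof (rule continuous_constant_on_closure[where S = "{u<..<v}" and f = F])
  have "\<forall>s \<in> {u..v}. \<bar>s - T\<bar> * (F s)\<^sup>2 = 0"
    using int uv by (subst (asm) integral_eq_0_iff) (auto intro!: continuous_intros F)
  then show "F s = 0" if "s \<in> {u<..<v}" for s
    using that T by fastforce
qed (use F uv s in auto)

text \<open>This is the bridge between the Lebesgue integral, used for Fubini and in the
  definitions, and the gauge integral, used for the Leibniz rule and the fundamental theorem of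
  calculus.\<close>

lemma LINT_continuous_eq_integral:
  fixes f :: "real \<Rightarrow> real"
  assumes "continuous_on {u..v} f"
  shows "(LINT t:{u..v}|lborel. f t) = integral {u..v} f"
  using assms by (intro set_borel_integral_eq_integral borel_integrable_atLeastAtMost')

lemma C1_on_has_real_derivative:
  assumes "C1_on S x" "t \<in> S"
  shows "(x has_real_derivative deriv_on S x t) (at t within S)"
  using assms unfolding C1_on_def differentiable_on_def
  by (simp add: has_real_derivative_iff_has_vector_derivative vector_derivative_works)

lemma C1_onI:
  assumes "a < b" "\<And>t. t \<in> {a..b} \<Longrightarrow> (x has_real_derivative f t) (at t within {a..b})"
    and "continuous_on {a..b} f"
  shows "C1_on {a..b} x" and "\<And>t. t \<in> {a..b} \<Longrightarrow> deriv_on {a..b} x t = f t"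
proof -
  show eq: "deriv_on {a..b} x t = f t" if "t \<in> {a..b}" for t
    using assms that by (intro vector_derivative_within_closed_interval)
      (auto simp: has_real_derivative_iff_has_vector_derivative)
  have "x differentiable_on {a..b}"
    unfolding differentiable_on_def using assms(2) real_differentiable_def by blast
  moreover have "continuous_on {a..b} (deriv_on {a..b} x)"
    by (rule continuous_on_eq[OF assms(3)]) (simp add: eq)
  ultimately show "C1_on {a..b} x" by (simp add: C1_on_def)
qed

lemma continuous_on_C1:
  assumes "C1_on S x"
  shows "continuous_on S x"
  using assms unfolding C1_on_def by (blast intro: differentiable_imp_continuous_on)

lemma sum_integrals_nonneg_eq_0:
  fixes f1 f2 :: "real \<Rightarrow> real"
  assumes "integral A f1 + integral B f2 = 0" "f1 integrable_on A" "f2 integrable_on B"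
    and "\<And>x. x \<in> A \<Longrightarrow> 0 \<le> f1 x" "\<And>x. x \<in> B \<Longrightarrow> 0 \<le> f2 x"
  shows "integral A f1 = 0" "integral B f2 = 0"
  using assms Henstock_Kurzweil_Integration.integral_nonneg[of f1 A]
    Henstock_Kurzweil_Integration.integral_nonneg[of f2 B] by auto

subsection \<open>The combined Caputo derivative as a single integral operator\<close>

locale combined_Caputo_setting =
  fixes a b \<gamma>1 \<gamma>2 :: real and \<alpha> \<beta> :: "real \<Rightarrow> real \<Rightarrow> real"
  assumes ab: "a < b"
    and \<alpha>_cont: "continuous_on ({a..b} \<times> {a..b}) (\<lambda>(t, \<tau>). \<alpha> t \<tau>)"
    and \<beta>_cont: "continuous_on ({a..b} \<times> {a..b}) (\<lambda>(t, \<tau>). \<beta> t \<tau>)"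
    and \<alpha>_range: "\<And>t \<tau>. t \<in> {a..b} \<Longrightarrow> \<tau> \<in> {a..b} \<Longrightarrow> \<alpha> t \<tau> \<in> {0<..<1}"
    and \<beta>_range: "\<And>t \<tau>. t \<in> {a..b} \<Longrightarrow> \<tau> \<in> {a..b} \<Longrightarrow> \<beta> t \<tau> \<in> {0<..<1}"
begin

definition K :: "real \<Rightarrow> real \<Rightarrow> real" where
  "K t \<tau> = \<gamma>1 * RL_kernel \<alpha> t \<tau> - \<gamma>2 * RL_kernel \<beta> \<tau> t"

abbreviation CD :: "(real \<Rightarrow> real) \<Rightarrow> real \<Rightarrow> real" where
  "CD \<equiv> combined_Caputo a b (\<gamma>1, \<gamma>2) \<alpha> \<beta>"

abbreviation path :: "(real \<Rightarrow> real) \<Rightarrow> real \<Rightarrow> real \<times> real \<times> real" where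
  "path \<equiv> fpath a b (\<gamma>1, \<gamma>2) \<alpha> \<beta>"

lemma weakly_singular_\<alpha>: "weakly_singular a b (RL_kernel \<alpha>)"
  using ab \<alpha>_cont \<alpha>_range by (intro weakly_singular_RL_kernel) auto

lemma weakly_singular_\<beta>: "weakly_singular a b (RL_kernel \<beta>)"
  using ab \<beta>_cont \<beta>_range by (intro weakly_singular_RL_kernel) auto

lemma weakly_singular_K: "weakly_singular a b K"
  unfolding K_def
  by (intro weakly_singular_diff weakly_singular_\<alpha> weakly_singular_transpose[OF weakly_singular_\<beta>])

lemma combined_Caputo_eq:
  assumes x: "C1_on {a..b} x" and t: "t \<in> {a..b}"
  shows "CD x t = (LINT \<tau>:{a..b}|lborel. K t \<tau> * deriv_on {a..b} x \<tau>)"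
proof -
  have "set_integrable lborel {a..b} (\<lambda>\<tau>. RL_kernel \<alpha> t \<tau> * deriv_on {a..b} x \<tau>)"
    "set_integrable lborel {a..b} (\<lambda>\<tau>. RL_kernel \<beta> \<tau> t * deriv_on {a..b} x \<tau>)"
    using x t unfolding C1_on_def
    by (auto intro: weakly_singular_integrable weakly_singular_\<alpha> weakly_singular_transpose[OF weakly_singular_\<beta>])
  then have "(LINT \<tau>:{a..b}|lborel. \<gamma>1 * (RL_kernel \<alpha> t \<tau> * deriv_on {a..b} x \<tau>) -
        \<gamma>2 * (RL_kernel \<beta> \<tau> t * deriv_on {a..b} x \<tau>)) =
      \<gamma>1 * (LINT \<tau>:{a..b}|lborel. RL_kernel \<alpha> t \<tau> * deriv_on {a..b} x \<tau>) -
      \<gamma>2 * (LINT \<tau>:{a..b}|lborel. RL_kernel \<beta> \<tau> t * deriv_on {a..b} x \<tau>)"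
    by (subst set_integral_diff) (auto simp: set_integrable_mult_right)
  then show ?thesis
    using t unfolding combined_Caputo_def left_Caputo_def right_Caputo_def K_def
    by (simp add: left_RL_integral_kernel[of t b] right_RL_integral_kernel[of a t] algebra_simps)
qed

lemma continuous_on_combined_Caputo:
  assumes x: "C1_on {a..b} x"
  shows "continuous_on {a..b} (CD x)"
proof (rule continuous_on_eq)
  show "continuous_on {a..b} (\<lambda>t. LINT \<tau>:{a..b}|lborel. K t \<tau> * deriv_on {a..b} x \<tau>)"
    using x unfolding C1_on_def by (intro weakly_singular_continuous weakly_singular_K) auto
qed (simp add: combined_Caputo_eq[OF x])

lemma D_space_iff: "(x, t) \<in> D_space a b (\<gamma>1, \<gamma>2) \<alpha> \<beta> \<longleftrightarrow> C1_on {a..b} x \<and> t \<in> {a..b}"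
  unfolding D_space_def using continuous_on_combined_Caputo by auto

lemma C1_on_add_mult:
  assumes x: "C1_on {a..b} x" and h: "C1_on {a..b} h"
  shows "C1_on {a..b} (\<lambda>s. x s + e * h s)"
    and "t \<in> {a..b} \<Longrightarrow>
      deriv_on {a..b} (\<lambda>s. x s + e * h s) t = deriv_on {a..b} x t + e * deriv_on {a..b} h t"
proof -
  have D: "((\<lambda>s. x s + e * h s) has_real_derivative deriv_on {a..b} x t + e * deriv_on {a..b} h t)
      (at t within {a..b})" if "t \<in> {a..b}" for t
    using C1_on_has_real_derivative[OF x that] C1_on_has_real_derivative[OF h that]
    by (auto intro!: derivative_eq_intros)
  have c: "continuous_on {a..b} (\<lambda>t. deriv_on {a..b} x t + e * deriv_on {a..b} h t)"
    using x h unfolding C1_on_def by (intro continuous_intros) auto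
  show "C1_on {a..b} (\<lambda>s. x s + e * h s)"
    by (rule C1_onI(1)[OF ab D c])
  show "t \<in> {a..b} \<Longrightarrow>
      deriv_on {a..b} (\<lambda>s. x s + e * h s) t = deriv_on {a..b} x t + e * deriv_on {a..b} h t"
    by (rule C1_onI(2)[OF ab D c])
qed

lemma combined_Caputo_add_mult:
  assumes x: "C1_on {a..b} x" and h: "C1_on {a..b} h" and t: "t \<in> {a..b}"
  shows "CD (\<lambda>s. x s + e * h s) t = CD x t + e * CD h t"
proof -
  have "set_integrable lborel {a..b} (\<lambda>\<tau>. K t \<tau> * deriv_on {a..b} x \<tau>)"
    "set_integrable lborel {a..b} (\<lambda>\<tau>. K t \<tau> * deriv_on {a..b} h \<tau>)"
    using x h t unfolding C1_on_def by (auto intro: weakly_singular_integrable weakly_singular_K)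
  then have "(LINT \<tau>:{a..b}|lborel. K t \<tau> * deriv_on {a..b} x \<tau> + e * (K t \<tau> * deriv_on {a..b} h \<tau>)) =
     CD x t + e * CD h t"
    by (subst set_integral_add) (auto simp: combined_Caputo_eq[OF _ t] x h)
  moreover have "(LINT \<tau>:{a..b}|lborel. K t \<tau> * deriv_on {a..b} x \<tau> + e * (K t \<tau> * deriv_on {a..b} h \<tau>)) =
     (LINT \<tau>:{a..b}|lborel. K t \<tau> * deriv_on {a..b} (\<lambda>s. x s + e * h s) \<tau>)"
    by (rule set_lebesgue_integral_cong) (auto simp: C1_on_add_mult(2)[OF x h] algebra_simps)
  ultimately show ?thesis
    by (simp add: combined_Caputo_eq[OF C1_on_add_mult(1)[OF x h] t])
qed

lemma D_norm_le:
  assumes h: "C1_on {a..b} h"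
  obtains B where "B > 0" "\<And>e. D_norm a b (\<gamma>1, \<gamma>2) \<alpha> \<beta> (\<lambda>s. e * h s) 0 \<le> \<bar>e\<bar> * B"
proof -
  have bnd: "\<exists>B>0. \<forall>s\<in>{a..b}. \<bar>u s\<bar> \<le> B" if "continuous_on {a..b} u" for u :: "real \<Rightarrow> real"
    using compact_imp_bounded[OF compact_continuous_image[OF that compact_Icc]]
    unfolding bounded_pos by auto
  obtain B where B: "B > 0" "\<And>s. s \<in> {a..b} \<Longrightarrow> \<bar>h s\<bar> \<le> B"
    using bnd[OF continuous_on_C1[OF h]] by blast
  obtain B' where B': "B' > 0" "\<And>s. s \<in> {a..b} \<Longrightarrow> \<bar>CD h s\<bar> \<le> B'"
    using bnd[OF continuous_on_combined_Caputo[OF h]] by blast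
  have z: "C1_on {a..b} (\<lambda>_. 0)"
    by (rule C1_onI(1)[OF ab, of _ "\<lambda>_. 0"]) auto
  have CD: "CD (\<lambda>s. e * h s) t = e * CD h t" if "t \<in> {a..b}" for t e
  proof -
    \<comment> \<open>Additivity with both functions 0 and factor 1 reads
      \<open>CD 0 = CD 0 + CD 0\<close>. Homogeneity then follows by adding \<open>e * h\<close> to
      the zero function.\<close>
    have "CD (\<lambda>_. 0) t = 0"
      using combined_Caputo_add_mult[OF z z that, of 1] by simp
    then show ?thesis using combined_Caputo_add_mult[OF z h that, of e] by simp
  qed
  have "D_norm a b (\<gamma>1, \<gamma>2) \<alpha> \<beta> (\<lambda>s. e * h s) 0 \<le> \<bar>e\<bar> * (B + B')" for e
  proof -
    have "(SUP s\<in>{a..b}. \<bar>e * h s\<bar>) \<le> \<bar>e\<bar> * B"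
      using ab B by (intro cSUP_least) (auto simp: abs_mult intro!: mult_left_mono)
    moreover have "(SUP s\<in>{a..b}. \<bar>CD (\<lambda>s. e * h s) s\<bar>) \<le> \<bar>e\<bar> * B'"
      using ab B' by (intro cSUP_least) (auto simp: CD abs_mult intro!: mult_left_mono)
    ultimately show ?thesis
      by (simp add: D_norm_def distrib_left)
  qed
  then show thesis
    using B B' by (intro that[of "B + B'"]) auto
qed

lemma continuous_on_path:
  assumes x: "C1_on {a..b} x" and F: "continuous_on ({a..b} \<times> UNIV) F"
  shows "continuous_on {a..b} (\<lambda>t. F (path x t))"
  unfolding fpath_def
  by (intro continuous_on_compose2[OF F] continuous_intros continuous_on_C1[OF x]
      continuous_on_combined_Caputo[OF x]) auto

subsection \<open>First variation\<close>

text \<open>Linearity of \<open>CD\<close> makes the path of \<open>x + e * h\<close> affine in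
  \<open>e\<close>, so the integrand can be differentiated along a line for each \<open>t\<close>.
  The Leibniz rule applies because this derivative is jointly continuous in \<open>e\<close> and
  \<open>t\<close>.\<close>

lemma has_real_derivative_J_direction:
  assumes L: "L differentiable_on ({a..b} \<times> UNIV)"
    and L2: "continuous_on ({a..b} \<times> UNIV) (L_d2 L)"
    and L3: "continuous_on ({a..b} \<times> UNIV) (L_d3 L)"
    and \<phi>: "\<phi> differentiable_on ({a..b} \<times> UNIV)"
    and x: "C1_on {a..b} x" and h: "C1_on {a..b} h" and T: "T \<in> {a..b}"
  shows "((\<lambda>e. J_functional a b (\<gamma>1, \<gamma>2) \<alpha> \<beta> L \<phi> (\<lambda>s. x s + e * h s) T) has_real_derivative
      integral {a..T} (\<lambda>t. L_d2 L (path x t) * h t + L_d3 L (path x t) * CD h t) +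
      phi_d2 \<phi> (T, x T) * h T) (at 0)"
proof -
  have sub: "{a..T} \<subseteq> {a..b}" using T by auto
  have Lc: "continuous_on ({a..b} \<times> UNIV) L"
    by (rule differentiable_imp_continuous_on[OF L])
  let ?q = "\<lambda>e t. (t, x t + e * h t, CD x t + e * CD h t)"
  have path: "path (\<lambda>s. x s + e * h s) t = ?q e t" if "t \<in> {a..b}" for e t
    by (simp add: fpath_def combined_Caputo_add_mult[OF x h that])
  have q: "continuous_on (UNIV \<times> {a..T}) (\<lambda>z. F (?q (fst z) (snd z)))"
    if "continuous_on ({a..b} \<times> UNIV) F" for F :: "real \<times> real \<times> real \<Rightarrow> real"
    using sub
    by (intro continuous_on_compose2[OF that] continuous_intros
        continuous_on_compose2[OF continuous_on_C1[OF x]] continuous_on_compose2[OF continuous_on_C1[OF h]]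
        continuous_on_compose2[OF continuous_on_combined_Caputo[OF x]]
        continuous_on_compose2[OF continuous_on_combined_Caputo[OF h]]) auto
  have hc: "continuous_on (UNIV \<times> {a..T}) (\<lambda>z :: real \<times> real. h (snd z))"
    and Dhc: "continuous_on (UNIV \<times> {a..T}) (\<lambda>z :: real \<times> real. CD h (snd z))"
    using sub by (auto intro!: continuous_on_compose2[OF continuous_on_C1[OF h]]
      continuous_on_compose2[OF continuous_on_combined_Caputo[OF h]] continuous_intros)
  have int: "(LINT t:{a..T}|lborel. L (path (\<lambda>s. x s + e * h s) t)) = integral {a..T} (\<lambda>t. L (?q e t))" for e
  proof -
    have "(LINT t:{a..T}|lborel. L (path (\<lambda>s. x s + e * h s) t)) =
        integral {a..T} (\<lambda>t. L (path (\<lambda>s. x s + e * h s) t))"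
      by (intro LINT_continuous_eq_integral continuous_on_subset[OF _ sub]
          continuous_on_path C1_on_add_mult(1) x h Lc)
    also have "\<dots> = integral {a..T} (\<lambda>t. L (?q e t))"
      by (rule integral_cong) (use path sub in auto)
    finally show ?thesis .
  qed
  have "((\<lambda>e. integral (cbox a T) (\<lambda>t. L (?q e t))) has_field_derivative
     integral (cbox a T) (\<lambda>t. L_d2 L (?q 0 t) * h t + L_d3 L (?q 0 t) * CD h t)) (at 0 within UNIV)"
  proof (rule leibniz_rule_field_derivative)
    show "((\<lambda>e. L (?q e t)) has_real_derivative
        L_d2 L (?q e t) * h t + L_d3 L (?q e t) * CD h t) (at e within UNIV)"
      if "t \<in> cbox a T" for e t
      using has_real_derivative_L_line[OF L, of t] that sub by auto
    show "(\<lambda>t. L (?q e t)) integrable_on cbox a T" for e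
    proof -
      have "continuous_on (cbox a T) (\<lambda>t. (\<lambda>z. L (?q (fst z) (snd z))) (e, t))"
        by (intro continuous_on_compose2[OF q[OF Lc]] continuous_intros) auto
      then show ?thesis by (intro integrable_continuous) simp
    qed
    show "continuous_on (UNIV \<times> cbox a T)
        (\<lambda>(e, t). L_d2 L (?q e t) * h t + L_d3 L (?q e t) * CD h t)"
      unfolding case_prod_unfold cbox_interval by (intro continuous_intros q L2 L3 hc Dhc)
  qed auto
  moreover have "((\<lambda>e. \<phi> (T, x T + e * h T)) has_real_derivative phi_d2 \<phi> (T, x T) * h T) (at 0)"
  proof (rule DERIV_cong[OF DERIV_chain2[where f = "\<lambda>u. \<phi> (T, u)" and g = "\<lambda>e. x T + e * h T"]])
    show "((\<lambda>u. \<phi> (T, u)) has_real_derivative phi_d2 \<phi> (T, x T)) (at (x T + 0 * h T))"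
      using has_real_derivative_phi_d2[OF \<phi> T] by simp
    show "((\<lambda>e. x T + e * h T) has_real_derivative h T) (at 0)"
      by (auto intro!: derivative_eq_intros)
  qed simp
  ultimately show ?thesis
    unfolding J_functional_def int by (auto intro!: derivative_eq_intros simp: fpath_def)
qed

text \<open>
  The variation is parametrised by its derivative \<open>f\<close>: integrating by parts in the \<open>l\<close> term and
  exchanging the order of integration in the \<open>g\<close> term leaves \<open>f\<close> multiplied by a known function.
\<close>

lemma first_variation_eq:
  fixes f g l :: "real \<Rightarrow> real"
  assumes f: "continuous_on {a..b} f" and g: "continuous_on {a..b} g" and l: "continuous_on {a..b} l"
    and T: "T \<in> {a..b}"
  defines "h \<equiv> \<lambda>t. integral {a..t} f"
  shows "integral {a..T} (\<lambda>t. l t * h t + g t * CD h t) + c * h T =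
    integral {a..T} (\<lambda>\<tau>. f \<tau> * (integral {a..T} l - integral {a..\<tau>} l + c)) +
    integral {a..b} (\<lambda>\<tau>. f \<tau> * (LINT t:{a..T}|lborel. K t \<tau> * g t))"
    and "C1_on {a..b} h" and "h a = 0"
proof -
  have sub: "{a..T} \<subseteq> {a..b}" using T by auto
  have hD: "(h has_real_derivative f t) (at t within {a..b})" if "t \<in> {a..b}" for t
    unfolding h_def using integral_has_real_derivative[OF f that] .
  show h: "C1_on {a..b} h" by (rule C1_onI(1)[OF ab hD f])
  have dh: "deriv_on {a..b} h t = f t" if "t \<in> {a..b}" for t
    using C1_onI(2)[OF ab hD f that] .
  show "h a = 0" by (simp add: h_def)
  let ?C = "\<lambda>\<tau>. LINT t:{a..T}|lborel. K t \<tau> * g t"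
  let ?E = "\<lambda>\<tau>. integral {a..T} l - integral {a..\<tau>} l + c"
  have hc: "continuous_on {a..b} h" and Dhc: "continuous_on {a..b} (CD h)"
    by (rule continuous_on_C1[OF h], rule continuous_on_combined_Caputo[OF h])
  have lc: "continuous_on {a..b} (\<lambda>\<tau>. integral {a..\<tau>} l)"
    by (rule indefinite_integral_continuous_1) (rule integrable_continuous_real[OF l])
  have Cc: "continuous_on {a..b} ?C"
    by (rule weakly_singular_continuous[OF weakly_singular_transpose[OF weakly_singular_K] sub
          continuous_on_subset[OF g sub]])
  have CDh: "CD h t = (LINT \<tau>:{a..b}|lborel. K t \<tau> * f \<tau>)" if "t \<in> {a..b}" for t
    unfolding combined_Caputo_eq[OF h that]
    by (rule set_lebesgue_integral_cong) (auto simp: dh)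
  have "integral {a..T} (\<lambda>t. g t * CD h t) = (LINT t:{a..T}|lborel. g t * CD h t)"
    by (intro LINT_continuous_eq_integral[symmetric] continuous_on_subset[OF _ sub]
        continuous_intros g Dhc)
  also have "\<dots> = (LINT t:{a..T}|lborel. g t * (LINT \<tau>:{a..b}|lborel. K t \<tau> * f \<tau>))"
    by (rule set_lebesgue_integral_cong) (use sub in \<open>auto simp: CDh\<close>)
  also have "\<dots> = (LINT \<tau>:{a..b}|lborel. f \<tau> * ?C \<tau>)"
    by (rule weakly_singular_Fubini[OF weakly_singular_K sub f g])
  also have "\<dots> = integral {a..b} (\<lambda>\<tau>. f \<tau> * ?C \<tau>)"
    by (intro LINT_continuous_eq_integral continuous_intros f Cc)
  finally have 1: "integral {a..T} (\<lambda>t. g t * CD h t) = integral {a..b} (\<lambda>\<tau>. f \<tau> * ?C \<tau>)" .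
  \<comment> \<open>The integrand is the derivative of \<open>h * ?E\<close>, since
    \<open>?E\<close> has derivative \<open>- l\<close>. As \<open>h a = 0\<close> and
    \<open>?E T = c\<close>, the boundary terms reduce to \<open>c * h T\<close>.\<close>
  have "((\<lambda>t. f t * ?E t - l t * h t) has_integral (h T * ?E T - h a * ?E a)) {a..T}"
  proof (rule fundamental_theorem_of_calculus)
    fix t assume "t \<in> {a..T}"
    then have t: "t \<in> {a..b}" using sub by auto
    have "((\<lambda>t. h t * ?E t) has_real_derivative f t * ?E t - l t * h t) (at t within {a..b})"
      using hD[OF t] integral_has_real_derivative[OF l t]
      by (auto intro!: derivative_eq_intros)
    then show "((\<lambda>t. h t * ?E t) has_vector_derivative f t * ?E t - l t * h t) (at t within {a..T})"
      unfolding has_real_derivative_iff_has_vector_derivative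
      by (rule has_vector_derivative_within_subset[OF _ sub])
  qed (use T in auto)
  then have "integral {a..T} (\<lambda>t. f t * ?E t - l t * h t) = c * h T"
    by (auto dest!: integral_unique simp: h_def)
  moreover have "integral {a..T} (\<lambda>t. f t * ?E t - l t * h t) =
      integral {a..T} (\<lambda>t. f t * ?E t) - integral {a..T} (\<lambda>t. l t * h t)"
    by (intro Henstock_Kurzweil_Integration.integral_diff integrable_continuous_real
        continuous_on_subset[OF _ sub] continuous_intros f l lc hc)
  moreover have "integral {a..T} (\<lambda>t. l t * h t + g t * CD h t) =
      integral {a..T} (\<lambda>t. l t * h t) + integral {a..T} (\<lambda>t. g t * CD h t)"
    by (intro Henstock_Kurzweil_Integration.integral_add integrable_continuous_real
        continuous_on_subset[OF _ sub] continuous_intros g l hc Dhc)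
  ultimately show "integral {a..T} (\<lambda>t. l t * h t + g t * CD h t) + c * h T =
      integral {a..T} (\<lambda>\<tau>. f \<tau> * ?E \<tau>) + integral {a..b} (\<lambda>\<tau>. f \<tau> * ?C \<tau>)"
    using 1 by simp
qed

text \<open>For \<tau> in [a,T] the order \<alpha> kernel is supported on t > \<tau>, giving a right
  integral based at \<open>T\<close>, and the order \<beta> kernel on t < \<tau>, giving a left
  integral based at \<open>a\<close>.\<close>

lemma kernel_integral_before:
  assumes g: "continuous_on {a..b} g" and T: "T \<in> {a..b}" and \<tau>: "\<tau> \<in> {a..T}"
  shows "(LINT t:{a..T}|lborel. K t \<tau> * g t) =
    \<gamma>1 * right_RL_integral \<alpha> T g \<tau> - \<gamma>2 * left_RL_integral \<beta> a g \<tau>"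
proof -
  have sub: "{a..T} \<subseteq> {a..b}" using T by auto
  have "set_integrable lborel {a..T} (\<lambda>t. RL_kernel \<alpha> t \<tau> * g t)"
    "set_integrable lborel {a..T} (\<lambda>t. RL_kernel \<beta> \<tau> t * g t)"
    using \<tau> sub
    by (auto intro!: weakly_singular_integrable[OF _ _ sub continuous_on_subset[OF g sub]]
        weakly_singular_\<beta> weakly_singular_transpose[OF weakly_singular_\<alpha>])
  then have "(LINT t:{a..T}|lborel. \<gamma>1 * (RL_kernel \<alpha> t \<tau> * g t) - \<gamma>2 * (RL_kernel \<beta> \<tau> t * g t)) =
      \<gamma>1 * (LINT t:{a..T}|lborel. RL_kernel \<alpha> t \<tau> * g t) -
      \<gamma>2 * (LINT t:{a..T}|lborel. RL_kernel \<beta> \<tau> t * g t)"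
    by (subst set_integral_diff) (auto simp: set_integrable_mult_right)
  then show ?thesis
    using \<tau> unfolding K_def
    by (simp add: left_RL_integral_kernel[of \<tau> T] right_RL_integral_kernel[of a \<tau>] algebra_simps)
qed

text \<open>For \<tau> in [T,b] no \<open>t\<close> in [a,T] exceeds \<tau>, so the order \<alpha>
  part vanishes. The remaining integral over [a,T] is the one from \<open>a\<close> minus the one
  from \<open>T\<close>.\<close>

lemma kernel_integral_after:
  assumes g: "continuous_on {a..b} g" and T: "T \<in> {a..b}" and \<tau>: "\<tau> \<in> {T..b}"
  shows "(LINT t:{a..T}|lborel. K t \<tau> * g t) =
    - \<gamma>2 * (left_RL_integral \<beta> a g \<tau> - left_RL_integral \<beta> T g \<tau>)"
proof -
  let ?k = "\<lambda>t. RL_kernel \<beta> \<tau> t * g t"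
  have int: "set_integrable lborel {u..v} ?k" if "{u..v} \<subseteq> {a..b}" for u v
    using \<tau> T that
    by (auto intro!: weakly_singular_integrable[OF weakly_singular_\<beta> _ that continuous_on_subset[OF g that]])
  note HK = set_borel_integral_eq_integral[OF int]
  have "(LINT t:{a..T}|lborel. K t \<tau> * g t) = (LINT t:{a..T}|lborel. - \<gamma>2 * ?k t)"
    by (rule set_lebesgue_integral_cong) (use \<tau> in \<open>auto simp: K_def RL_kernel_def\<close>)
  also have "\<dots> = - \<gamma>2 * integral {a..T} ?k"
    using T HK(2)[of a T] by (subst set_integral_mult_right) simp
  also have "integral {a..T} ?k = integral {a..b} ?k - integral {T..b} ?k"
    using T HK(1)[of a b] Henstock_Kurzweil_Integration.integral_combine[of a T b ?k] by simp
  also have "\<dots> = left_RL_integral \<beta> a g \<tau> - left_RL_integral \<beta> T g \<tau>"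
    using \<tau> T HK(2)[of a b] HK(2)[of T b] by (simp add: left_RL_integral_kernel[of \<tau> b])
  finally show ?thesis .
qed

section \<open>Necessary conditions at a local minimizer\<close>

lemma local_minimizer_direction:
  assumes min: "local_minimizer a b (\<gamma>1, \<gamma>2) \<alpha> \<beta> L \<phi> xa x T"
    and h: "C1_on {a..b} h" "h a = 0"
    and D: "((\<lambda>e. J_functional a b (\<gamma>1, \<gamma>2) \<alpha> \<beta> L \<phi> (\<lambda>s. x s + e * h s) T) has_real_derivative d) (at 0)"
  shows "d = 0"
proof -
  from min obtain \<epsilon> where x: "C1_on {a..b} x" and T: "T \<in> {a..b}" and xa: "x a = xa" and \<epsilon>: "\<epsilon> > 0"
    and le: "\<And>y S. C1_on {a..b} y \<Longrightarrow> S \<in> {a..b} \<Longrightarrow> y a = xa \<Longrightarrow>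
      D_norm a b (\<gamma>1, \<gamma>2) \<alpha> \<beta> (\<lambda>s. x s - y s) (T - S) < \<epsilon> \<Longrightarrow>
      J_functional a b (\<gamma>1, \<gamma>2) \<alpha> \<beta> L \<phi> x T \<le> J_functional a b (\<gamma>1, \<gamma>2) \<alpha> \<beta> L \<phi> y S"
    unfolding local_minimizer_def D_space_iff by blast
  obtain B where B: "B > 0" "\<And>e. D_norm a b (\<gamma>1, \<gamma>2) \<alpha> \<beta> (\<lambda>s. e * h s) 0 \<le> \<bar>e\<bar> * B"
    using D_norm_le[OF h(1)] by blast
  \<comment> \<open>For \<bar>e\<bar> below \<epsilon> / B the perturbed function lies in the
    \<epsilon>-ball, and \<open>h a = 0\<close> preserves its initial value. So e = 0 is a local
    minimum of a function of one real variable.\<close>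
  show ?thesis
  proof (rule DERIV_local_min[OF D])
    show "0 < \<epsilon> / B" using \<epsilon> B by simp
    show "\<forall>e. \<bar>0 - e\<bar> < \<epsilon> / B \<longrightarrow>
        J_functional a b (\<gamma>1, \<gamma>2) \<alpha> \<beta> L \<phi> (\<lambda>s. x s + 0 * h s) T
        \<le> J_functional a b (\<gamma>1, \<gamma>2) \<alpha> \<beta> L \<phi> (\<lambda>s. x s + e * h s) T"
    proof (intro allI impI)
      fix e assume "\<bar>0 - e\<bar> < \<epsilon> / B"
      then have "\<bar>e\<bar> * B < \<epsilon>" using B by (simp add: field_simps)
      then have "D_norm a b (\<gamma>1, \<gamma>2) \<alpha> \<beta> (\<lambda>s. - e * h s) 0 < \<epsilon>"
        using B(2)[of "- e"] by simp
      then have "D_norm a b (\<gamma>1, \<gamma>2) \<alpha> \<beta> (\<lambda>s. x s - (x s + e * h s)) (T - T) < \<epsilon>"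
        by simp
      from le[OF C1_on_add_mult(1)[OF x h(1)] T _ this] h(2) xa
      show "J_functional a b (\<gamma>1, \<gamma>2) \<alpha> \<beta> L \<phi> (\<lambda>s. x s + 0 * h s) T
        \<le> J_functional a b (\<gamma>1, \<gamma>2) \<alpha> \<beta> L \<phi> (\<lambda>s. x s + e * h s) T"
        by simp
    qed
  qed
qed

text \<open>Here \<open>x\<close> is kept and only the terminal time varies. As \<open>T\<close> is
  interior, it can move in both directions, so the derivative in \<open>S\<close> vanishes at
  \<open>T\<close>.\<close>

lemma local_minimizer_terminal_time:
  assumes min: "local_minimizer a b (\<gamma>1, \<gamma>2) \<alpha> \<beta> L \<phi> xa x T"
    and L: "continuous_on ({a..b} \<times> UNIV) L" and \<phi>: "\<phi> differentiable_on ({a..b} \<times> UNIV)"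
    and T: "a < T" "T < b"
  shows "L (path x T) + phi_d1 a b \<phi> (T, x T) + phi_d2 \<phi> (T, x T) * deriv_on {a..b} x T = 0"
proof -
  from min obtain \<epsilon> where x: "C1_on {a..b} x" and xa: "x a = xa" and \<epsilon>: "\<epsilon> > 0"
    and le: "\<And>y S. C1_on {a..b} y \<Longrightarrow> S \<in> {a..b} \<Longrightarrow> y a = xa \<Longrightarrow>
      D_norm a b (\<gamma>1, \<gamma>2) \<alpha> \<beta> (\<lambda>s. x s - y s) (T - S) < \<epsilon> \<Longrightarrow>
      J_functional a b (\<gamma>1, \<gamma>2) \<alpha> \<beta> L \<phi> x T \<le> J_functional a b (\<gamma>1, \<gamma>2) \<alpha> \<beta> L \<phi> y S"
    unfolding local_minimizer_def D_space_iff by blast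
  have T': "T \<in> {a..b}" and at: "at T within {a..b} = at T"
    using T by (auto intro: at_within_Icc_at)
  have Lp: "continuous_on {a..b} (\<lambda>t. L (path x t))"
    by (rule continuous_on_path[OF x L])
  have D: "((\<lambda>S. integral {a..S} (\<lambda>t. L (path x t)) + \<phi> (S, x S)) has_real_derivative
      L (path x T) + (phi_d1 a b \<phi> (T, x T) + phi_d2 \<phi> (T, x T) * deriv_on {a..b} x T)) (at T)"
    using integral_has_real_derivative[OF Lp T']
      has_real_derivative_phi_graph[OF ab \<phi> T' C1_on_has_real_derivative[OF x T']]
    unfolding at by (rule DERIV_add)
  have J: "J_functional a b (\<gamma>1, \<gamma>2) \<alpha> \<beta> L \<phi> x S = integral {a..S} (\<lambda>t. L (path x t)) + \<phi> (S, x S)"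
    if "S \<in> {a..b}" for S
    unfolding J_functional_def
    using LINT_continuous_eq_integral[OF continuous_on_subset[OF Lp, of "{a..S}"]] that by auto
  have "L (path x T) + (phi_d1 a b \<phi> (T, x T) + phi_d2 \<phi> (T, x T) * deriv_on {a..b} x T) = 0"
  proof (rule DERIV_local_min[OF D])
    show "0 < min \<epsilon> (min (T - a) (b - T))" using \<epsilon> T by simp
    show "\<forall>S. \<bar>T - S\<bar> < min \<epsilon> (min (T - a) (b - T)) \<longrightarrow>
      integral {a..T} (\<lambda>t. L (path x t)) + \<phi> (T, x T) \<le> integral {a..S} (\<lambda>t. L (path x t)) + \<phi> (S, x S)"
    proof (intro allI impI)
      fix S assume S: "\<bar>T - S\<bar> < min \<epsilon> (min (T - a) (b - T))"
      then have S': "S \<in> {a..b}" by (auto simp: abs_if split: if_splits)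
      \<comment> \<open>The zero function is written as \<open>0 * x s\<close> so that
        \<open>D_norm_le\<close> with e = 0 bounds its norm by 0.\<close>
      have "D_norm a b (\<gamma>1, \<gamma>2) \<alpha> \<beta> (\<lambda>s. x s - x s) (T - S) = D_norm a b (\<gamma>1, \<gamma>2) \<alpha> \<beta> (\<lambda>s. 0 * x s) 0 + \<bar>T - S\<bar>"
        by (simp add: D_norm_def)
      also have "\<dots> < \<epsilon>"
        using D_norm_le[OF x] S by (metis abs_zero add.commute add_le_same_cancel2 dual_order.strict_trans2 min_less_iff_conj mult_zero_left)
      finally show "integral {a..T} (\<lambda>t. L (path x t)) + \<phi> (T, x T) \<le> integral {a..S} (\<lambda>t. L (path x t)) + \<phi> (S, x S)"
        using le[OF x S' xa] J[OF S'] J[OF T'] by simp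
    qed
  qed
  then show ?thesis by simp
qed

text \<open>These are the Euler-Lagrange equations in integrated form. They are identities between
  functions of \<tau>, and they transfer differentiability from the integral of \<open>l\<close> to
  the combination of fractional integrals.\<close>

lemma local_minimizer_Euler_Lagrange:
  assumes L: "L differentiable_on ({a..b} \<times> UNIV)"
    and L2: "continuous_on ({a..b} \<times> UNIV) (L_d2 L)"
    and L3: "continuous_on ({a..b} \<times> UNIV) (L_d3 L)"
    and \<phi>: "\<phi> differentiable_on ({a..b} \<times> UNIV)"
    and min: "local_minimizer a b (\<gamma>1, \<gamma>2) \<alpha> \<beta> L \<phi> xa x T"
    and T: "a < T" "T < b"
  defines "l \<equiv> \<lambda>t. L_d2 L (path x t)" and "g \<equiv> \<lambda>t. L_d3 L (path x t)"
  shows "\<And>\<tau>. \<tau> \<in> {a..T} \<Longrightarrow>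
      \<gamma>2 * left_RL_integral \<beta> a g \<tau> - \<gamma>1 * right_RL_integral \<alpha> T g \<tau> =
      integral {a..T} l - integral {a..\<tau>} l + phi_d2 \<phi> (T, x T)"
    and "\<And>\<tau>. \<tau> \<in> {T..b} \<Longrightarrow> \<gamma>2 * (left_RL_integral \<beta> a g \<tau> - left_RL_integral \<beta> T g \<tau>) = 0"
    and "phi_d2 \<phi> (T, x T) = 0"
proof -
  from min have x: "C1_on {a..b} x" unfolding local_minimizer_def D_space_iff by blast
  have T': "T \<in> {a..b}" and sub: "{a..T} \<subseteq> {a..b}" "{T..b} \<subseteq> {a..b}" using T by auto
  have lc: "continuous_on {a..b} l" and gc: "continuous_on {a..b} g"
    unfolding l_def g_def by (intro continuous_on_path x L2 L3)+
  define c where "c = phi_d2 \<phi> (T, x T)"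
  define C where "C = (\<lambda>\<tau>. LINT t:{a..T}|lborel. K t \<tau> * g t)"
  define E where "E = (\<lambda>\<tau>. integral {a..T} l - integral {a..\<tau>} l + c)"
  \<comment> \<open>\<open>C\<close> plus the jump term \<open>E\<close> on \<open>[a,T]\<close> may be discontinuous at \<open>T\<close>; multiplying by \<open>\<bar>\<tau> - T\<bar>\<close>
    gives an admissible (continuous) variation whose pairing with it is a weighted square.\<close>
  define f where "f = (\<lambda>\<tau>. \<bar>\<tau> - T\<bar> * C \<tau> + max 0 (T - \<tau>) * E \<tau>)"
  have Cc: "continuous_on {a..b} C"
    unfolding C_def
    by (rule weakly_singular_continuous[OF weakly_singular_transpose[OF weakly_singular_K] sub(1)
          continuous_on_subset[OF gc sub(1)]])
  have "continuous_on {a..b} (\<lambda>\<tau>. integral {a..\<tau>} l)"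
    by (rule indefinite_integral_continuous_1) (rule integrable_continuous_real[OF lc])
  then have Ec: "continuous_on {a..b} E"
    unfolding E_def by (intro continuous_intros)
  have fc: "continuous_on {a..b} f"
    unfolding f_def by (intro continuous_intros Cc Ec)
  note fv = first_variation_eq[OF fc gc lc T']
  have "integral {a..T} (\<lambda>t. l t * integral {a..t} f + g t * CD (\<lambda>t. integral {a..t} f) t) +
      c * integral {a..T} f = 0"
    unfolding l_def g_def c_def
    by (rule local_minimizer_direction[OF min fv(2,3)
          has_real_derivative_J_direction[OF L L2 L3 \<phi> x fv(2) T']])
  then have "integral {a..T} (\<lambda>\<tau>. f \<tau> * E \<tau>) + integral {a..b} (\<lambda>\<tau>. f \<tau> * C \<tau>) = 0"
    using fv(1)[of c] unfolding E_def C_def by simp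
  moreover have "integral {a..b} (\<lambda>\<tau>. f \<tau> * C \<tau>) =
      integral {a..T} (\<lambda>\<tau>. f \<tau> * C \<tau>) + integral {T..b} (\<lambda>\<tau>. f \<tau> * C \<tau>)"
    using T by (intro Henstock_Kurzweil_Integration.integral_combine[symmetric]
        integrable_continuous_real continuous_intros fc Cc) auto
  moreover have "integral {a..T} (\<lambda>\<tau>. f \<tau> * E \<tau>) + integral {a..T} (\<lambda>\<tau>. f \<tau> * C \<tau>) =
      integral {a..T} (\<lambda>\<tau>. f \<tau> * E \<tau> + f \<tau> * C \<tau>)"
    by (intro Henstock_Kurzweil_Integration.integral_add[symmetric] integrable_continuous_real
        continuous_on_subset[OF _ sub(1)] continuous_intros fc Cc Ec)
  \<comment> \<open>On [a,T] both weights in \<open>f\<close> equal T - \<tau>, so \<open>f\<close>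
    is the weight times C + E. On [T,b] the second weight is 0, and \<open>f\<close> is the weight
    times C.\<close>
  moreover have "integral {a..T} (\<lambda>\<tau>. f \<tau> * E \<tau> + f \<tau> * C \<tau>) =
      integral {a..T} (\<lambda>\<tau>. \<bar>\<tau> - T\<bar> * (C \<tau> + E \<tau>)\<^sup>2)"
    by (rule integral_cong) (auto simp: f_def power2_eq_square algebra_simps)
  moreover have "integral {T..b} (\<lambda>\<tau>. f \<tau> * C \<tau>) = integral {T..b} (\<lambda>\<tau>. \<bar>\<tau> - T\<bar> * (C \<tau>)\<^sup>2)"
    by (rule integral_cong) (auto simp: f_def power2_eq_square)
  ultimately have sum: "integral {a..T} (\<lambda>\<tau>. \<bar>\<tau> - T\<bar> * (C \<tau> + E \<tau>)\<^sup>2) +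
      integral {T..b} (\<lambda>\<tau>. \<bar>\<tau> - T\<bar> * (C \<tau>)\<^sup>2) = 0"
    by simp
  have CE: "continuous_on {a..T} (\<lambda>\<tau>. C \<tau> + E \<tau>)" and C': "continuous_on {T..b} C"
    by (intro continuous_intros continuous_on_subset[OF Cc] continuous_on_subset[OF Ec] sub)+
  have zero: "integral {a..T} (\<lambda>\<tau>. \<bar>\<tau> - T\<bar> * (C \<tau> + E \<tau>)\<^sup>2) = 0"
    "integral {T..b} (\<lambda>\<tau>. \<bar>\<tau> - T\<bar> * (C \<tau>)\<^sup>2) = 0"
    by (rule sum_integrals_nonneg_eq_0[OF sum];
        auto intro!: integrable_continuous_real continuous_intros CE C')+
  have before: "C \<tau> + E \<tau> = 0" if "\<tau> \<in> {a..T}" for \<tau>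
    using weighted_square_integral_eq_0[OF CE T(1) _ zero(1) that] by simp
  have after: "C \<tau> = 0" if "\<tau> \<in> {T..b}" for \<tau>
    using weighted_square_integral_eq_0[OF C' T(2) _ zero(2) that] by simp
  show "\<gamma>2 * left_RL_integral \<beta> a g \<tau> - \<gamma>1 * right_RL_integral \<alpha> T g \<tau> =
      integral {a..T} l - integral {a..\<tau>} l + phi_d2 \<phi> (T, x T)" if "\<tau> \<in> {a..T}" for \<tau>
    using before[OF that] kernel_integral_before[OF gc T' that]
    unfolding C_def E_def c_def by simp
  show "\<gamma>2 * (left_RL_integral \<beta> a g \<tau> - left_RL_integral \<beta> T g \<tau>) = 0" if "\<tau> \<in> {T..b}" for \<tau>
    using after[OF that] kernel_integral_after[OF gc T' that] unfolding C_def by simp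
  \<comment> \<open>At \<tau> = T both identities hold: C + c = 0 from the left, as
    \<open>E T = c\<close>, and C = 0 from the right.\<close>
  show "phi_d2 \<phi> (T, x T) = 0"
    using before[of T] after[of T] T by (simp add: E_def c_def)
qed

end

text \<open>Minimality yields differentiability only of the weighted combinations of fractional
  integrals. Each Euler-Lagrange equation is therefore stated twice: for the derivative of the
  combination, and with separate Riemann-Liouville derivatives at points where these exist.\<close>

theorem theorem46:
  fixes a b T xa \<gamma>1 \<gamma>2 :: real
    and \<alpha> \<beta> :: "real \<Rightarrow> real \<Rightarrow> real"
    and L :: "real \<times> real \<times> real \<Rightarrow> real"
    and \<phi> :: "real \<times> real \<Rightarrow> real"
    and x :: "real \<Rightarrow> real"
  assumes "a < b"
    and "continuous_on ({a..b} \<times> {a..b}) (\<lambda>(t, \<tau>). \<alpha> t \<tau>)"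
    and "continuous_on ({a..b} \<times> {a..b}) (\<lambda>(t, \<tau>). \<beta> t \<tau>)"
    and "\<And>t \<tau>. t \<in> {a..b} \<Longrightarrow> \<tau> \<in> {a..b} \<Longrightarrow> \<alpha> t \<tau> \<in> {0<..<1}"
    and "\<And>t \<tau>. t \<in> {a..b} \<Longrightarrow> \<tau> \<in> {a..b} \<Longrightarrow> \<beta> t \<tau> \<in> {0<..<1}"
    and "\<gamma>1 \<in> {0..1}" and "\<gamma>2 \<in> {0..1}" and "(\<gamma>1, \<gamma>2) \<noteq> (0, 0)"
    and L_diff: "L differentiable_on ({a..b} \<times> UNIV)"
    and L_d2_cont: "continuous_on ({a..b} \<times> UNIV) (L_d2 L)"
    and L_d3_cont: "continuous_on ({a..b} \<times> UNIV) (L_d3 L)"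
    and "C1_terminal a b \<phi>"
    and min: "local_minimizer a b (\<gamma>1, \<gamma>2) \<alpha> \<beta> L \<phi> xa x T"
    and T_interior: "a < T" "T < b"
  defines "p \<equiv> fpath a b (\<gamma>1, \<gamma>2) \<alpha> \<beta> x"
  defines "g \<equiv> (\<lambda>t. L_d3 L (p t))"
  shows
    "(\<forall>t\<in>{a..T}. ((\<lambda>s. \<gamma>2 * left_RL_integral \<beta> a g s - \<gamma>1 * right_RL_integral \<alpha> T g s)
        has_real_derivative - L_d2 L (p t)) (at t within {a..T})) \<and>
     (\<forall>t\<in>{a..T}. (\<gamma>2 \<noteq> 0 \<longrightarrow> left_RL_differentiable b \<beta> a g t) \<longrightarrow>
        (\<gamma>1 \<noteq> 0 \<longrightarrow> right_RL_differentiable a \<alpha> T g t) \<longrightarrow>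
        L_d2 L (p t) + dual_derivative a b T (\<gamma>2, \<gamma>1) \<beta> \<alpha> g t = 0) \<and>
     (\<forall>t\<in>{T..b}. ((\<lambda>s. \<gamma>2 * (left_RL_integral \<beta> a g s - left_RL_integral \<beta> T g s))
        has_real_derivative 0) (at t within {T..b})) \<and>
     (\<forall>t\<in>{T..b}. left_RL_differentiable b \<beta> a g t \<longrightarrow> left_RL_differentiable b \<beta> T g t \<longrightarrow>
        \<gamma>2 * (left_RL_derivative b \<beta> a g t - left_RL_derivative b \<beta> T g t) = 0) \<and>
     L (p T) + phi_d1 a b \<phi> (T, x T)
       + deriv_on {a..b} x T * (\<gamma>2 * left_RL_integral \<beta> T g T - \<gamma>1 * right_RL_integral \<alpha> T g T) = 0 \<and>
     \<gamma>1 * right_RL_integral \<alpha> T g T - \<gamma>2 * left_RL_integral \<beta> T g T + phi_d2 \<phi> (T, x T) = 0 \<and>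
     \<gamma>2 * (left_RL_integral \<beta> T g b - left_RL_integral \<beta> a g b) = 0"
proof -
  interpret combined_Caputo_setting a b \<gamma>1 \<gamma>2 \<alpha> \<beta>
    using assms by unfold_locales auto
  have \<phi>: "\<phi> differentiable_on ({a..b} \<times> UNIV)"
    using \<open>C1_terminal a b \<phi>\<close> by (simp add: C1_terminal_def)
  let ?A = "\<lambda>s. \<gamma>2 * left_RL_integral \<beta> a g s - \<gamma>1 * right_RL_integral \<alpha> T g s"
  let ?B = "\<lambda>s. \<gamma>2 * (left_RL_integral \<beta> a g s - left_RL_integral \<beta> T g s)"
  let ?l = "\<lambda>t. L_d2 L (p t)"
  note EL = local_minimizer_Euler_Lagrange[OF L_diff L_d2_cont L_d3_cont \<phi> min T_interior,
      folded p_def, folded g_def]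
  have sub: "{a..T} \<subseteq> {a..b}" "{T..b} \<subseteq> {a..b}" using T_interior by auto
  have x: "C1_on {a..b} x" using min unfolding local_minimizer_def D_space_iff by blast
  have lc: "continuous_on {a..T} ?l"
    unfolding p_def by (rule continuous_on_subset[OF continuous_on_path[OF x L_d2_cont] sub(1)])
  have 1: "(?A has_real_derivative - ?l t) (at t within {a..T})" if t: "t \<in> {a..T}" for t
  proof -
    have "((\<lambda>\<tau>. integral {a..T} ?l - integral {a..\<tau>} ?l + phi_d2 \<phi> (T, x T))
        has_real_derivative - ?l t) (at t within {a..T})"
      using integral_has_real_derivative[OF lc t] by (auto intro!: derivative_eq_intros)
    then show ?thesis
      by (rule has_field_derivative_transform_within[OF _ zero_less_one t]) (simp add: EL(1))
  qed
  have 2: "(?B has_real_derivative 0) (at t within {T..b})" if t: "t \<in> {T..b}" for t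
    by (rule has_field_derivative_transform_within[OF DERIV_const zero_less_one t]) (simp add: EL(2))
  have left: "(left_RL_integral \<beta> c g has_real_derivative left_RL_derivative b \<beta> c g t) (at t within {c..b})"
    if "left_RL_differentiable b \<beta> c g t" for c t
    using that unfolding left_RL_differentiable_def left_RL_derivative_def
    by (simp add: has_real_derivative_iff_has_vector_derivative vector_derivative_works)
  have right: "(right_RL_integral \<alpha> T g has_real_derivative - right_RL_derivative a \<alpha> T g t) (at t within {a..T})"
    if "right_RL_differentiable a \<alpha> T g t" for t
    using that unfolding right_RL_differentiable_def right_RL_derivative_def
    by (simp add: has_real_derivative_iff_has_vector_derivative vector_derivative_works)
  have uniq: "d = d'" if "(F has_real_derivative d) (at t within {u..v})"
    "(F has_real_derivative d') (at t within {u..v})" "u < v" "t \<in> {u..v}" for F d d' t u v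
    using that vector_derivative_within_closed_interval
    by (metis has_real_derivative_iff_has_vector_derivative)
  have 3: "?l t + dual_derivative a b T (\<gamma>2, \<gamma>1) \<beta> \<alpha> g t = 0"
    if t: "t \<in> {a..T}" and dl: "\<gamma>2 \<noteq> 0 \<longrightarrow> left_RL_differentiable b \<beta> a g t"
      and dr: "\<gamma>1 \<noteq> 0 \<longrightarrow> right_RL_differentiable a \<alpha> T g t" for t
  proof -
    \<comment> \<open>A zero coefficient makes the product constantly 0, which is differentiable
      whatever the fractional integral does. Otherwise the derivative within [a,b] is restricted to
      [a,T], where derivatives are unique because a < T.\<close>
    have l: "((\<lambda>s. \<gamma>2 * left_RL_integral \<beta> a g s) has_real_derivative \<gamma>2 * left_RL_derivative b \<beta> a g t)
        (at t within {a..T})"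
      using DERIV_subset[OF left sub(1)] dl by (cases "\<gamma>2 = 0") (auto intro: DERIV_cmult)
    have r: "((\<lambda>s. \<gamma>1 * right_RL_integral \<alpha> T g s) has_real_derivative \<gamma>1 * - right_RL_derivative a \<alpha> T g t)
        (at t within {a..T})"
      using DERIV_cmult[OF right] dr by (cases "\<gamma>1 = 0") auto
    show ?thesis
      using uniq[OF 1[OF t] DERIV_diff[OF l r] T_interior(1) t] by (simp add: dual_derivative_def)
  qed
  have 4: "\<gamma>2 * (left_RL_derivative b \<beta> a g t - left_RL_derivative b \<beta> T g t) = 0"
    if t: "t \<in> {T..b}" and d: "left_RL_differentiable b \<beta> a g t" "left_RL_differentiable b \<beta> T g t" for t
    using uniq[OF DERIV_cmult[OF DERIV_diff[OF DERIV_subset[OF left[OF d(1)] sub(2)] left[OF d(2)]]] 2[OF t] T_interior(2) t]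
    by simp
  \<comment> \<open>The term with \<open>deriv_on {a..b} x T\<close> drops out since its
    coefficient, the derivative of \<phi> in the second argument, is 0. The bracket multiplying it
    in the theorem is also 0, by \<open>RL_integral_at_base\<close>.\<close>
  have 5: "L (p T) + phi_d1 a b \<phi> (T, x T) = 0"
    using local_minimizer_terminal_time[OF min differentiable_imp_continuous_on[OF L_diff] \<phi> T_interior] EL(3)
    by (simp add: p_def)
  have 6: "\<gamma>2 * (left_RL_integral \<beta> T g b - left_RL_integral \<beta> a g b) = 0"
    using EL(2)[of b] T_interior by auto
  show ?thesis
    using 1 2 3 4 5 6 EL(3) by (simp add: RL_integral_at_base)
qed

end
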